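(* Let $\mathfrak g=\mathfrak{sl}_n$, $n\geqslant3$. For every $\gamma\in Q^\vee$ and every $i\in\mathbb{Z}$, the value at $q=1$ of the affine inverse Kazhdan–Lusztig polynomial $\mathbf m^{w_\gamma}_{w_i}(q)$ is $$\mathbf m^{w_\gamma}_{w_i}=-\sum_{k=1}^n z_i\big(\langle\epsilon_k,\gamma\rangle\epsilon_k\big).$$
   Context: $Q^\vee=\{(a_1,\dots,a_n)\in\mathbb{Z}^n:\sum a_k=0\}$ is the coroot lattice of $\mathfrak{sl}_n$, $\epsilon_1,\dots,\epsilon_n$ the standard basis of $\mathbb{Z}^n$, $\langle\epsilon_k,\gamma\rangle=a_k$ for $\gamma=(a_1,\dots,a_n)$, $W=S_n$. $\widehat W=Q^\vee\rtimes S_n$ is the affine Weyl group, with $t_\gamma$ the element attached to $\gamma\in Q^\vee$ and simple reflections $s_k=(k\ k+1)$ for $1\leqslant k\leqslant n-1$ and $s_0=t_{\epsilon_1-\epsilon_n}\cdot(1\ n)$; $\ell$ is the length, $\varepsilon(w)=(-1)^{\ell(w)}$, $\preccurlyeq$ the Bruhat order. $w_\gamma$ is the shortest element of the coset $t_\gamma W$. For $i\in\mathbb{Z}$, with $[i]\in\{0,\dots,n-1\}$ the class of $i$ mod $n$: $w_i=s_{[i]}s_{[i-1]}\cdots s_{[1]}s_0$ for $i>0$, $w_0=s_0$, $w_i=s_{[i]}s_{[i+1]}\cdots s_{[-1]}s_0$ for $i<0$. For $i\in\mathbb{Z}$, $1\leqslant k\leqslant n$, $a\in\mathbb{Z}$: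 $z_i(a\epsilon_k)=|\mathbb{Z}_{\leqslant i}\cap[k,k+(a-1)n]\cap(k+n\mathbb{Z})|$ for $a\geqslant0$, and $z_i(a\epsilon_k)=-|\mathbb{Z}_{\leqslant i}\cap[k+an,k-n]\cap(k+n\mathbb{Z})|$ for $a\leqslant0$ (an interval $[x,y]$ with $y<x$ is empty). The Hecke algebra of $\widehat W$ over $\mathbb{Z}[q^{\pm1}]$ has basis $H_w$ with $H_wH_v=H_{wv}$ if $\ell(wv)=\ell(w)+\ell(v)$ and $(H_s+1)(H_s-q)=0$ for simple reflections $s$. $C_v=\sum_{w\preccurlyeq v}P_{w,v}(q)H_w$ is the Kazhdan–Lusztig basis: $P_{v,v}=1$, $P_{w,v}\in\mathbb{Z}[q]$ of degree $\leqslant(\ell(v)-\ell(w)-1)/2$ for $w\prec v$, and $\overline{C_v}=q^{-\ell(v)}C_v$ for the involution $\overline q=q^{-1}$, $\overline{H_w}=H_{w^{-1}}^{-1}$. The inverse Kazhdan–Lusztig polynomials are defined by $H_w=\sum_{v\preccurlyeq w}\varepsilon(wv^{-1})\mathbf m^w_v(q)C_v$ (and $\mathbf m^w_v(q)=0$ if $v\not\preccurlyeq w$); $\mathbf m^w_v=\mathbf m^w_v(1)$. *)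

theory Defs
  imports
    "HOL-Algebra.Sym_Groups"
    "HOL-Library.Poly_Mapping"
    "HOL-Computational_Algebra.Polynomial"
begin

section \<open>The affine Weyl group of type A\<close>

text \<open>Vectors in \<open>\<int>\<^sup>n\<close> are functions vanishing outside \<open>{1..n}\<close>, so the pairing of
  \<open>\<gamma>\<close> with the \<open>k\<close>-th standard basis vector is \<open>\<gamma> k\<close>.\<close>

definition coroot_lattice :: "nat \<Rightarrow> (nat \<Rightarrow> int) set" where
  "coroot_lattice n = {\<gamma>. (\<forall>k. k \<notin> {1..n} \<longrightarrow> \<gamma> k = 0) \<and> (\<Sum>k=1..n. \<gamma> k) = 0}"

type_synonym aff = "(nat \<Rightarrow> int) \<times> (nat \<Rightarrow> nat)"

text \<open>The pair \<open>(\<gamma>, \<sigma>)\<close> stands for \<open>t\<^sub>\<gamma> \<sigma>\<close>. A permutation sends the \<open>k\<close>-th basis vector to the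
  \<open>\<sigma> k\<close>-th one, so the \<open>k\<close>-th coordinate of \<open>\<sigma> \<delta>\<close> is \<open>\<delta> (\<sigma>\<inverse> k)\<close>.\<close>

definition affine_weyl :: "nat \<Rightarrow> aff monoid" where
  "affine_weyl n =
    \<lparr> carrier = coroot_lattice n \<times> carrier (sym_group n),
      mult = (\<lambda>(\<gamma>, \<sigma>) (\<delta>, \<tau>). (\<lambda>k. \<gamma> k + \<delta> (inv' \<sigma> k), \<sigma> \<circ> \<tau>)),
      one = (\<lambda>_. 0, id) \<rparr>"

definition translation :: "(nat \<Rightarrow> int) \<Rightarrow> aff" where
  "translation \<gamma> = (\<gamma>, id)"

definition finite_weyl :: "nat \<Rightarrow> aff set" where
  "finite_weyl n = {\<lambda>_. 0} \<times> carrier (sym_group n)"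

definition simple_refl :: "nat \<Rightarrow> nat \<Rightarrow> aff" where
  "simple_refl n k =
    (if k = 0
     then ((\<lambda>j. (if j = 1 then 1 else 0) - (if j = n then 1 else 0)), transpose 1 n)
     else (\<lambda>_. 0, transpose k (Suc k)))"

definition word_prod :: "nat \<Rightarrow> nat list \<Rightarrow> aff" where
  "word_prod n ks =
    foldr (\<lambda>k w. simple_refl n k \<otimes>\<^bsub>affine_weyl n\<^esub> w) ks \<one>\<^bsub>affine_weyl n\<^esub>"

definition len :: "nat \<Rightarrow> aff \<Rightarrow> nat" where
  "len n w = (LEAST l. \<exists>ks. length ks = l \<and> set ks \<subseteq> {..<n} \<and> word_prod n ks = w)"

definition aff_sign :: "nat \<Rightarrow> aff \<Rightarrow> int" where
  "aff_sign n w = (- 1) ^ len n w"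

definition reflections :: "nat \<Rightarrow> aff set" where
  "reflections n =
    {x \<otimes>\<^bsub>affine_weyl n\<^esub> simple_refl n k \<otimes>\<^bsub>affine_weyl n\<^esub> inv\<^bsub>affine_weyl n\<^esub> x
      | x k. x \<in> carrier (affine_weyl n) \<and> k < n}"

definition bruhat_step :: "nat \<Rightarrow> aff \<Rightarrow> aff \<Rightarrow> bool" where
  "bruhat_step n u v \<longleftrightarrow>
    (\<exists>t\<in>reflections n. v = u \<otimes>\<^bsub>affine_weyl n\<^esub> t) \<and> len n u < len n v"

definition bruhat_le :: "nat \<Rightarrow> aff \<Rightarrow> aff \<Rightarrow> bool" where
  "bruhat_le n u v \<longleftrightarrow> u \<in> carrier (affine_weyl n) \<and> (bruhat_step n)\<^sup>*\<^sup>* u v"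

definition w_gamma :: "nat \<Rightarrow> (nat \<Rightarrow> int) \<Rightarrow> aff" where
  "w_gamma n \<gamma> =
    arg_min (len n) (\<lambda>w. w \<in> translation \<gamma> <#\<^bsub>affine_weyl n\<^esub> finite_weyl n)"

text \<open>The indices of the word are \<open>[i], [i-1], \<dots>, [1], [0]\<close> for \<open>i \<ge> 0\<close> and
  \<open>[i], [i+1], \<dots>, [-1], [0]\<close> for \<open>i < 0\<close>.\<close>

definition w_int :: "nat \<Rightarrow> int \<Rightarrow> aff" where
  "w_int n i =
    word_prod n (map (\<lambda>j. nat (j mod int n)) (if i \<ge> 0 then rev [0..i] else [i..0]))"

text \<open>\<open>z_fun n i k a\<close> is \<open>z\<^sub>i(a \<epsilon>\<^sub>k)\<close>.\<close>

definition z_fun :: "nat \<Rightarrow> int \<Rightarrow> nat \<Rightarrow> int \<Rightarrow> int" where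
  "z_fun n i k a =
    (if a \<ge> 0
     then int (card ({..i} \<inter> {int k .. int k + (a - 1) * int n} \<inter> range (\<lambda>j. int k + int n * j)))
     else - int (card ({..i} \<inter> {int k + a * int n .. int k - int n} \<inter> range (\<lambda>j. int k + int n * j))))"


section \<open>The Hecke algebra and Kazhdan--Lusztig theory\<close>

text \<open>Finitely supported functions \<open>\<int> \<rightarrow> \<int>\<close> with convolution product form the ring \<open>\<int>[q\<^sup>\<plusminus>\<^sup>1]\<close>.\<close>

type_synonym laurent = "int \<Rightarrow>\<^sub>0 int"

abbreviation q_pow :: "int \<Rightarrow> laurent" where
  "q_pow k \<equiv> Poly_Mapping.single k 1"

definition laurent_of_poly :: "int poly \<Rightarrow> laurent" where
  "laurent_of_poly p = poly (map_poly of_int p) (q_pow 1)"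

definition laurent_bar :: "laurent \<Rightarrow> laurent" where
  "laurent_bar = Poly_Mapping.map_key uminus"

text \<open>An associative unital \<open>\<int>[q\<^sup>\<plusminus>\<^sup>1]\<close>-algebra, with scalar multiplication \<open>scale\<close>, which has the
  basis \<open>H\<^sub>w\<close> and satisfies the relations of the Hecke algebra. These data are unique up to unique
  isomorphism.\<close>

locale hecke_algebra = Modules.module scale
  for scale :: "laurent \<Rightarrow> 'h::ring_1 \<Rightarrow> 'h" +
  fixes n :: nat and H :: "aff \<Rightarrow> 'h"
  assumes scale_mult_left: "scale a x * y = scale a (x * y)"
    and scale_mult_right: "x * scale a y = scale a (x * y)"
    and inj_H: "inj_on H (carrier (affine_weyl n))"
    and independent_H: "independent (H ` carrier (affine_weyl n))"
    and span_H: "span (H ` carrier (affine_weyl n)) = UNIV"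
    and H_mult: "\<lbrakk>w \<in> carrier (affine_weyl n); v \<in> carrier (affine_weyl n);
        len n (w \<otimes>\<^bsub>affine_weyl n\<^esub> v) = len n w + len n v\<rbrakk>
      \<Longrightarrow> H w * H v = H (w \<otimes>\<^bsub>affine_weyl n\<^esub> v)"
    and H_quadratic: "k < n \<Longrightarrow>
      (H (simple_refl n k) + 1) * (H (simple_refl n k) - scale (q_pow 1) 1) = 0"
begin

definition bar_involution :: "('h \<Rightarrow> 'h) \<Rightarrow> bool" where
  "bar_involution bar \<longleftrightarrow>
    (\<forall>x y. bar (x + y) = bar x + bar y) \<and>
    (\<forall>x y. bar (x * y) = bar x * bar y) \<and>
    (\<forall>x. bar (bar x) = x) \<and>
    (\<forall>a x. bar (scale a x) = scale (laurent_bar a) (bar x)) \<and>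
    (\<forall>w \<in> carrier (affine_weyl n).
      bar (H w) * H (inv\<^bsub>affine_weyl n\<^esub> w) = 1 \<and> H (inv\<^bsub>affine_weyl n\<^esub> w) * bar (H w) = 1)"

definition kl_basis :: "('h \<Rightarrow> 'h) \<Rightarrow> (aff \<Rightarrow> aff \<Rightarrow> int poly) \<Rightarrow> (aff \<Rightarrow> 'h) \<Rightarrow> bool" where
  "kl_basis bar P C \<longleftrightarrow>
    (\<forall>v \<in> carrier (affine_weyl n).
      C v = (\<Sum>w | bruhat_le n w v. scale (laurent_of_poly (P w v)) (H w)) \<and>
      P v v = 1 \<and>
      (\<forall>w. bruhat_le n w v \<and> w \<noteq> v \<longrightarrow>
        real (degree (P w v)) \<le> (real (len n v) - real (len n w) - 1) / 2) \<and>
      bar (C v) = scale (q_pow (- int (len n v))) (C v))"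

definition inverse_kl_polys :: "(aff \<Rightarrow> 'h) \<Rightarrow> (aff \<Rightarrow> aff \<Rightarrow> int poly) \<Rightarrow> bool" where
  "inverse_kl_polys C m \<longleftrightarrow>
    (\<forall>w \<in> carrier (affine_weyl n).
      H w = (\<Sum>v | bruhat_le n v w.
        scale (of_int (aff_sign n (w \<otimes>\<^bsub>affine_weyl n\<^esub> inv\<^bsub>affine_weyl n\<^esub> v))
               * laurent_of_poly (m w v)) (C v)) \<and>
      (\<forall>v \<in> carrier (affine_weyl n). \<not> bruhat_le n v w \<longrightarrow> m w v = 0))"

end

end

theory Submission
  imports Defs
begin

text \<open>Let \<open>N\<close> be the quotient of the antispherical module of the affine Hecke algebra in which only the
  Kazhdan--Lusztig basis elements at the identity and at the elements \<open>w\<^sub>i\<close> survive. In \<open>N\<close> the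
  coefficient of \<open>C\<close> at \<open>w\<^sub>i\<close> in the image of \<open>H\<^sub>w\<close> is, up to sign, the inverse Kazhdan--Lusztig polynomial.
  We define \<open>N\<close> by explicit matrices, so that what has to be shown is that \<open>C\<^sub>v\<close> acts on the generator
  by \<open>0\<close> for all other \<open>v\<close>. The image of \<open>C\<^sub>v\<close> is self-dual and its coefficients
  are Laurent polynomials confined to one half of the range symmetric under the duality, hence zero.
  At \<open>q = 1\<close> the module is, up to a sign twist, the permutation module of the affine symmetric group on \<open>\<int>\<close>
  with differences of neighbouring basis vectors as basis and with the half-infinite sum of the basis vectors at
  indices \<open>\<le> 0\<close> as generator. The translation by \<open>\<gamma>\<close> moves that half line, and the coefficients of the
  displacement are the numbers \<open>z\<^sub>i\<close>.\<close>


section \<open>Affine permutations\<close>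

text \<open>The matrices come from the multiplication rule for \<open>C_s = H_s + 1\<close>:
  \<open>C_s C_v\<close> is \<open>(q + 1) C_v\<close> if \<open>s v < v\<close>, and otherwise
  \<open>C_{sv}\<close> plus terms \<open>mu(z,v) q^((l(v)-l(z)+1)/2) C_z\<close> with
  \<open>s z < z < v\<close>. Among the surviving elements only neighbours on the line of indices
  interact, with length difference one; hence the entries 1 and q. The resulting operators satisfy
  Temperley-Lieb relations, which imply the braid relations. The bound \<open>n >= 3\<close> gives
  the two neighbours of an index different residues and leaves only Coxeter relations of lengths 2
  and 3. The vector of \<open>H_w\<close> is read off a reduced word, which calls for Matsumoto's
  theorem and hence for an explicit length function.

  The crux is a degree bound for the coordinates of \<open>H_w\<close>. They are inverse
  Kazhdan-Lusztig polynomials up to sign, but this is known only once the other \<open>C_v\<close>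
  are seen to act by 0, so the bound has to come from the recursion along a word. There the diagonal
  entry q adds 2 to the doubled degree while the length grows by 1, so the naive estimate exceeds
  the bound by one.\<close>

locale affine_A =
  fixes n :: nat
  assumes n_ge_3: "3 \<le> n"
begin

abbreviation "\<W> \<equiv> affine_weyl n"
abbreviation "\<C> \<equiv> carrier (affine_weyl n)"

text \<open>Everything is built by multiplication on the left: the module is a left module, and the
  words of \<open>w_int\<close> grow at their left end.\<close>

definition refl_mult :: "nat \<Rightarrow> aff \<Rightarrow> aff" where
  "refl_mult k w = simple_refl n k \<otimes>\<^bsub>\<W>\<^esub> w"

lemma n_pos: "0 < n"
  using n_ge_3 by simp

section \<open>The semidirect product as a group\<close>

lemma carrier_iff: "(\<gamma>, \<sigma>) \<in> \<C> \<longleftrightarrow> \<gamma> \<in> coroot_lattice n \<and> \<sigma> permutes {1..n}"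
  by (simp add: affine_weyl_def sym_group_carrier)

lemma mult_eq: "(\<gamma>, \<sigma>) \<otimes>\<^bsub>\<W>\<^esub> (\<delta>, \<tau>) = (\<lambda>k. \<gamma> k + \<delta> (inv' \<sigma> k), \<sigma> \<circ> \<tau>)"
  by (simp add: affine_weyl_def)

lemma one_eq: "\<one>\<^bsub>\<W>\<^esub> = (\<lambda>_. 0, id)"
  by (simp add: affine_weyl_def)

lemma lattice_permute:
  assumes "\<gamma> \<in> coroot_lattice n" "\<sigma> permutes {1..n}"
  shows "(\<lambda>k. \<gamma> (\<sigma> k)) \<in> coroot_lattice n"
proof -
  have "(\<Sum>k=1..n. \<gamma> (\<sigma> k)) = (\<Sum>k=1..n. \<gamma> k)"
    using sum.permute[OF assms(2), of \<gamma>] by (simp add: o_def)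
  moreover have "\<gamma> (\<sigma> k) = 0" if "k \<notin> {1..n}" for k
  proof -
    have "\<sigma> k = k" using permutes_not_in[OF assms(2) that] .
    then show ?thesis using assms(1) that by (auto simp: coroot_lattice_def)
  qed
  ultimately show ?thesis using assms(1) by (simp add: coroot_lattice_def)
qed

lemma lattice_add:
  assumes "\<gamma> \<in> coroot_lattice n" "\<delta> \<in> coroot_lattice n"
  shows "(\<lambda>k. \<gamma> k + \<delta> k) \<in> coroot_lattice n"
  using assms by (auto simp: coroot_lattice_def sum.distrib)

lemma lattice_neg:
  assumes "\<gamma> \<in> coroot_lattice n"
  shows "(\<lambda>k. - \<gamma> k) \<in> coroot_lattice n"
  using assms by (auto simp: coroot_lattice_def sum_negf)

lemma zero_in_lattice: "(\<lambda>_. 0) \<in> coroot_lattice n"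
  by (simp add: coroot_lattice_def)

lemma inv_comp_permutes:
  assumes "\<sigma> permutes {1..n}" "\<tau> permutes {1..n}"
  shows "inv' (\<sigma> \<circ> \<tau>) k = inv' \<tau> (inv' \<sigma> k)"
  using o_inv_distrib[OF permutes_bij[OF assms(1)] permutes_bij[OF assms(2)]] by simp

lemma group_affine_weyl: "group \<W>"
proof (rule groupI)
  fix x y assume xy: "x \<in> \<C>" "y \<in> \<C>"
  obtain a s b t where e: "x = (a, s)" "y = (b, t)" by (cases x, cases y)
  have h: "a \<in> coroot_lattice n" "s permutes {1..n}" "b \<in> coroot_lattice n" "t permutes {1..n}"
    using xy by (simp_all add: e carrier_iff)
  show "x \<otimes>\<^bsub>\<W>\<^esub> y \<in> \<C>"
    unfolding e mult_eq carrier_iff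
    using h lattice_add lattice_permute permutes_inv permutes_compose by meson
next
  show "\<one>\<^bsub>\<W>\<^esub> \<in> \<C>" by (simp add: one_eq carrier_iff zero_in_lattice permutes_id)
next
  fix x y z assume xyz: "x \<in> \<C>" "y \<in> \<C>" "z \<in> \<C>"
  obtain a s b t c u where e: "x = (a, s)" "y = (b, t)" "z = (c, u)" by (cases x, cases y, cases z)
  have h: "s permutes {1..n}" "t permutes {1..n}"
    using xyz by (simp_all add: e carrier_iff)
  show "x \<otimes>\<^bsub>\<W>\<^esub> y \<otimes>\<^bsub>\<W>\<^esub> z = x \<otimes>\<^bsub>\<W>\<^esub> (y \<otimes>\<^bsub>\<W>\<^esub> z)"
    unfolding e mult_eq by (simp add: inv_comp_permutes[OF h] o_assoc add.assoc)
next
  fix x assume "x \<in> \<C>"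
  then show "\<one>\<^bsub>\<W>\<^esub> \<otimes>\<^bsub>\<W>\<^esub> x = x" by (cases x) (simp add: one_eq mult_eq)
next
  fix x assume x: "x \<in> \<C>"
  obtain a s where e: "x = (a, s)" by (cases x)
  have h: "a \<in> coroot_lattice n" "s permutes {1..n}"
    using x by (simp_all add: e carrier_iff)
  have "(\<lambda>k. - a (s k), inv' s) \<in> \<C>"
    using h lattice_neg[OF lattice_permute] permutes_inv by (simp add: carrier_iff)
  moreover have "(\<lambda>k. - a (s k), inv' s) \<otimes>\<^bsub>\<W>\<^esub> x = \<one>\<^bsub>\<W>\<^esub>"
    using h by (simp add: e mult_eq one_eq permutes_inv_inv permutes_inv_o)
  ultimately show "\<exists>y\<in>\<C>. y \<otimes>\<^bsub>\<W>\<^esub> x = \<one>\<^bsub>\<W>\<^esub>" by blast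
qed

sublocale W: group "affine_weyl n"
  by (rule group_affine_weyl)

lemma simple_refl_closed: "k < n \<Longrightarrow> simple_refl n k \<in> \<C>"
  by (auto simp: simple_refl_def carrier_iff zero_in_lattice coroot_lattice_def sum_subtractf
      sum.delta intro!: permutes_swap_id)

lemma simple_refl_sq: "k < n \<Longrightarrow> simple_refl n k \<otimes>\<^bsub>\<W>\<^esub> simple_refl n k = \<one>\<^bsub>\<W>\<^esub>"
  using n_ge_3 by (auto simp: simple_refl_def mult_eq one_eq transpose_def fun_eq_iff inv_transpose_eq)

lemma inv_simple_refl: "k < n \<Longrightarrow> inv\<^bsub>\<W>\<^esub> (simple_refl n k) = simple_refl n k"
  by (simp add: W.inv_equality simple_refl_closed simple_refl_sq)

lemma refl_mult_closed: "\<lbrakk>k < n; w \<in> \<C>\<rbrakk> \<Longrightarrow> refl_mult k w \<in> \<C>"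
  by (simp add: refl_mult_def simple_refl_closed)

lemma refl_mult_twice [simp]: "\<lbrakk>k < n; w \<in> \<C>\<rbrakk> \<Longrightarrow> refl_mult k (refl_mult k w) = w"
  by (simp add: refl_mult_def W.m_assoc[symmetric] simple_refl_closed simple_refl_sq)

lemma word_prod_Nil: "word_prod n [] = \<one>\<^bsub>\<W>\<^esub>"
  by (simp add: word_prod_def)

lemma word_prod_Cons: "word_prod n (k # ks) = refl_mult k (word_prod n ks)"
  by (simp add: word_prod_def refl_mult_def)

lemma word_prod_closed: "set ks \<subseteq> {..<n} \<Longrightarrow> word_prod n ks \<in> \<C>"
  by (induction ks) (auto simp: word_prod_Nil word_prod_Cons refl_mult_closed)

text \<open>The element \<open>(\<gamma>, \<sigma>)\<close> permutes \<open>\<int>\<close> by sending \<open>k + n m\<close>, \<open>1 \<le> k \<le> n\<close>, to \<open>\<sigma> k + n (m + \<gamma> (\<sigma> k))\<close>;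
  \<open>aff_perm_inv\<close> is the inverse of this permutation, and \<open>aff_swap k\<close> is the permutation of the \<open>k\<close>-th
  simple reflection.\<close>

definition window_pos :: "int \<Rightarrow> nat" where
  "window_pos j = nat ((j - 1) mod int n) + 1"

definition aff_perm_inv :: "aff \<Rightarrow> int \<Rightarrow> int" where
  "aff_perm_inv w j =
    int (inv' (snd w) (window_pos j)) + int n * ((j - 1) div int n - fst w (window_pos j))"

definition aff_swap :: "nat \<Rightarrow> int \<Rightarrow> int" where
  "aff_swap k j =
    (if j mod int n = int k then j + 1 else if (j - 1) mod int n = int k then j - 1 else j)"

lemma window_pos_mem: "window_pos j \<in> {1..n}"
  using n_pos by (simp add: window_pos_def nat_less_iff Suc_le_eq)

lemma window_pos_eq: 
  assumes "r \<in> {1..n}"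
  shows "window_pos (int r + int n * m) = r" "(int r + int n * m - 1) div int n = m"
proof -
  have a: "int r + int n * m - 1 = (int r - 1) + int n * m" by simp
  have b: "(int r - 1) div int n = 0" "(int r - 1) mod int n = int r - 1" using assms by auto
  show "(int r + int n * m - 1) div int n = m" unfolding a using n_pos b by simp
  show "window_pos (int r + int n * m) = r" unfolding window_pos_def a using n_pos b assms by auto
qed

lemma window_decomp: "j = int (window_pos j) + int n * ((j - 1) div int n)"
proof -
  have "int (window_pos j) = (j - 1) mod int n + 1" using n_pos by (simp add: window_pos_def)
  then show ?thesis using mult_div_mod_eq[of "int n" "j - 1"] by linarith
qed

lemma window_cases: obtains r m where "r \<in> {1..n}" "j = int r + int n * m"
  using window_decomp window_pos_mem by blast

lemma aff_perm_inv_window: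
  assumes "r \<in> {1..n}"
  shows "aff_perm_inv (\<gamma>, \<sigma>) (int r + int n * m) = int (inv' \<sigma> r) + int n * (m - \<gamma> r)"
  by (simp add: aff_perm_inv_def window_pos_eq[OF assms])

lemma aff_perm_inv_periodic: "aff_perm_inv w (j + int n * m) = aff_perm_inv w j + int n * m"
proof -
  obtain r l where r: "r \<in> {1..n}" "j = int r + int n * l" by (rule window_cases)
  then have e: "j + int n * m = int r + int n * (l + m)" by (simp add: algebra_simps)
  obtain \<gamma> \<sigma> where w: "w = (\<gamma>, \<sigma>)" by (cases w)
  show ?thesis
    using aff_perm_inv_window[OF r(1), of \<gamma> \<sigma> "l + m"] aff_perm_inv_window[OF r(1), of \<gamma> \<sigma> l]
    unfolding e[symmetric] r(2)[symmetric] w[symmetric] by (simp add: algebra_simps)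
qed

lemma aff_swap_periodic: "aff_swap k (j + int n * m) = aff_swap k j + int n * m"
proof -
  have "(j + int n * m - 1) mod int n = (j - 1) mod int n"
    by (metis add.commute add_diff_eq mod_mult_self2)
  then show ?thesis by (simp add: aff_swap_def)
qed

text \<open>Passing to inverses turns left multiplication by a simple reflection into
  precomposition, that is, into an exchange of the values at neighbouring positions. This is why the
  inverse permutation is the one recorded.\<close>

lemma aff_perm_inv_refl_mult:
  assumes "k < n" "w \<in> \<C>"
  shows "aff_perm_inv (refl_mult k w) j = aff_perm_inv w (aff_swap k j)"
proof -
  obtain r m where r: "r \<in> {1..n}" and j: "j = int r + int n * m" by (rule window_cases)
  obtain \<gamma> \<sigma> where w: "w = (\<gamma>, \<sigma>)" by (cases w)
  have \<sigma>: "\<sigma> permutes {1..n}" using assms by (simp add: w carrier_iff)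
  have m1: "int r mod int n = (if r = n then 0 else int r)" using r by auto
  have m2: "(int r - 1) mod int n = int r - 1" using r by auto
  have p: "aff_swap k j = aff_swap k (int r) + int n * m" unfolding j by (rule aff_swap_periodic)
  \<comment> \<open>Each value is written as a window element plus a multiple of n. Only for
    \<open>k = 0\<close> does the swap leave the window: n goes to 1 of the next window, and 1 to n
    of the previous one.\<close>
  have q: "aff_swap k (int r) = (if k = 0 then (if r = n then int 1 + int n * 1 else
      if r = 1 then int n + int n * (-1) else int r + int n * 0)
      else int (transpose k (Suc k) r) + int n * 0)"
    using assms(1) r n_ge_3 by (auto simp: aff_swap_def m1 m2 transpose_def)
  show ?thesis
  proof (cases "k = 0")
    case True
    have t: "transpose 1 n permutes {1..n}" using n_pos by (intro permutes_swap_id) auto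
    have i: "inv' (transpose 1 n \<circ> \<sigma>) r = inv' \<sigma> (transpose 1 n r)"
      using inv_comp_permutes[OF t \<sigma>] by (simp add: inv_transpose_eq)
    have s: "refl_mult k w = (\<lambda>j. (if j = 1 then 1 else 0) - (if j = n then 1 else 0) + \<gamma> (transpose 1 n j),
        transpose 1 n \<circ> \<sigma>)"
      by (simp add: refl_mult_def simple_refl_def True w mult_eq inv_transpose_eq)
    have L: "aff_perm_inv (refl_mult k w) j = int (inv' \<sigma> (transpose 1 n r)) +
       int n * (m - ((if r = 1 then 1 else 0) - (if r = n then 1 else 0) + \<gamma> (transpose 1 n r)))"
      unfolding s j aff_perm_inv_window[OF r] i by simp
    consider "r = n" | "r = 1" | "r \<noteq> 1" "r \<noteq> n" by blast
    then show ?thesis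
    proof cases
      case 1
      have "aff_swap k j = int 1 + int n * (1 + m)" using p q True 1 by (simp add: algebra_simps)
      moreover have "1 \<in> {1..n}" using n_pos by simp
      ultimately have "aff_perm_inv w (aff_swap k j) = int (inv' \<sigma> 1) + int n * (1 + m - \<gamma> 1)"
        unfolding w by (simp only: aff_perm_inv_window)
      then show ?thesis unfolding L using 1 n_ge_3 by (simp add: algebra_simps)
    next
      case 2
      have "aff_swap k j = int n + int n * (-1 + m)" using p q True 2 n_ge_3 by (simp add: algebra_simps)
      moreover have "n \<in> {1..n}" using n_pos by simp
      ultimately have "aff_perm_inv w (aff_swap k j) = int (inv' \<sigma> n) + int n * (-1 + m - \<gamma> n)"
        unfolding w by (simp only: aff_perm_inv_window)
      then show ?thesis unfolding L using 2 n_ge_3 by (simp add: algebra_simps)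
    next
      case 3
      have "aff_swap k j = int r + int n * m" using p q True 3 n_ge_3 by (simp add: algebra_simps)
      then have "aff_perm_inv w (aff_swap k j) = int (inv' \<sigma> r) + int n * (m - \<gamma> r)"
        unfolding w by (simp only: aff_perm_inv_window[OF r])
      then show ?thesis unfolding L using 3 r by simp
    qed
  next
    case False
    have t: "transpose k (Suc k) permutes {1..n}" using assms(1) False by (intro permutes_swap_id) auto
    have i: "inv' (transpose k (Suc k) \<circ> \<sigma>) r = inv' \<sigma> (transpose k (Suc k) r)"
      using inv_comp_permutes[OF t \<sigma>] by (simp add: inv_transpose_eq)
    have s: "refl_mult k w = (\<lambda>j. \<gamma> (transpose k (Suc k) j), transpose k (Suc k) \<circ> \<sigma>)"
      using False by (simp add: refl_mult_def simple_refl_def w mult_eq inv_transpose_eq)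
    have "transpose k (Suc k) r \<in> {1..n}" using permutes_in_image[OF t, of r] r by simp
    then show ?thesis unfolding s p q using False
      by (simp add: w j aff_perm_inv_window[OF r] i aff_perm_inv_window)
  qed
qed

lemma aff_perm_inv_one: "aff_perm_inv \<one>\<^bsub>\<W>\<^esub> j = j"
proof -
  obtain r m where r: "r \<in> {1..n}" and j: "j = int r + int n * m" by (rule window_cases)
  show ?thesis unfolding j one_eq aff_perm_inv_window[OF r] by simp
qed

lemma aff_perm_inv_inj:
  assumes "w \<in> \<C>" "v \<in> \<C>" "\<And>j. aff_perm_inv w j = aff_perm_inv v j"
  shows "w = v"
proof -
  obtain a s b t where e: "w = (a, s)" "v = (b, t)" by (cases w, cases v)
  have h: "a \<in> coroot_lattice n" "s permutes {1..n}" "b \<in> coroot_lattice n" "t permutes {1..n}"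
    using assms by (simp_all add: e carrier_iff)
  have eq: "inv' s r = inv' t r \<and> a r = b r" if r: "r \<in> {1..n}" for r
  proof -
    have "inv' s r \<in> {1..n}" "inv' t r \<in> {1..n}"
      using r permutes_in_image[OF permutes_inv[OF h(2)], of r]
        permutes_in_image[OF permutes_inv[OF h(4)], of r] by simp_all
    note m = this
    have x: "int (inv' s r) + int n * (- a r) = int (inv' t r) + int n * (- b r)"
      using assms(3)[of "int r + int n * 0"] by (simp only: e aff_perm_inv_window[OF r]) simp
    show ?thesis using window_pos_eq[OF m(1), of "- a r"] window_pos_eq[OF m(2), of "- b r"] x by simp
  qed
  have "a = b"
  proof
    fix r show "a r = b r" using eq[of r] h(1,3) by (cases "r \<in> {1..n}") (auto simp: coroot_lattice_def)
  qed
  moreover have "inv' s = inv' t"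
  proof
    fix r show "inv' s r = inv' t r"
      using eq[of r] permutes_not_in[OF permutes_inv[OF h(2)], of r]
        permutes_not_in[OF permutes_inv[OF h(4)], of r]
      by (cases "r \<in> {1..n}") simp_all
  qed
  ultimately show ?thesis using h by (metis e permutes_inv_inv)
qed

text \<open>On residue classes the permutation induces the bijection \<open>inv' \<sigma>\<close>.
  In particular the values at two incongruent positions never differ by a multiple of n.\<close>

lemma aff_perm_inv_cong_iff:
  assumes "w \<in> \<C>"
  shows "aff_perm_inv w i mod int n = aff_perm_inv w j mod int n \<longleftrightarrow> i mod int n = j mod int n"
proof -
  obtain r m where r: "r \<in> {1..n}" and i: "i = int r + int n * m" by (rule window_cases)
  obtain s l where s: "s \<in> {1..n}" and j: "j = int s + int n * l" by (rule window_cases)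
  obtain \<gamma> \<sigma> where w: "w = (\<gamma>, \<sigma>)" by (cases w)
  have \<sigma>: "\<sigma> permutes {1..n}" using assms by (simp add: w carrier_iff)
  have u: "x mod int n = y mod int n \<longleftrightarrow> x = y" if "x \<in> {1..int n}" "y \<in> {1..int n}" for x y
  proof
    assume "x mod int n = y mod int n"
    then have "(x - 1) mod int n = (y - 1) mod int n" by (metis mod_diff_left_eq)
    then show "x = y" using that by simp
  qed simp
  have "inv' \<sigma> r \<in> {1..n}" "inv' \<sigma> s \<in> {1..n}"
    using r s permutes_in_image[OF permutes_inv[OF \<sigma>], of r]
      permutes_in_image[OF permutes_inv[OF \<sigma>], of s] by simp_all
  then have "aff_perm_inv w i mod int n = aff_perm_inv w j mod int n \<longleftrightarrow> inv' \<sigma> r = inv' \<sigma> s"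
    unfolding w i j aff_perm_inv_window[OF r] aff_perm_inv_window[OF s]
    using u[of "int (inv' \<sigma> r)" "int (inv' \<sigma> s)"] by simp
  also have "\<dots> \<longleftrightarrow> r = s" using permutes_inj[OF permutes_inv[OF \<sigma>]] by (auto dest: injD)
  also have "\<dots> \<longleftrightarrow> i mod int n = j mod int n" using u[of "int r" "int s"] r s by (simp add: i j)
  finally show ?thesis .
qed

end

section \<open>Length and descents\<close>

lemma periodic_sum_shift:
  fixes f :: "int \<Rightarrow> int"
  assumes "\<And>j. f (j + int n) = f j"
  shows "(\<Sum>j\<in>{int k..<int k + int n}. f j) = (\<Sum>j\<in>{0..<int n}. f j)"
proof (induction k)
  case (Suc k)
  show ?case
  proof (cases "n = 0")
    case False
    have "{int k..<int k + int n} = insert (int k) {int (Suc k)..<int k + int n}" using False by auto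
    moreover have "{int (Suc k)..<int (Suc k) + int n} = insert (int k + int n) {int (Suc k)..<int k + int n}"
      using False by auto
    ultimately show ?thesis using Suc assms[of "int k"] by simp
  qed simp
qed simp

context affine_A
begin

text \<open>The subtracted quotient makes the term n-periodic in i and in j separately and zero at
  the identity. Within the window \<open>{0..<int n}\<close> it is 0 for \<open>i <= j\<close> and
  -1 for \<open>j < i\<close>.\<close>

definition inv_term :: "aff \<Rightarrow> int \<Rightarrow> int \<Rightarrow> int" where
  "inv_term w i j =
    \<bar>(aff_perm_inv w j - aff_perm_inv w i) div int n - (j - i) div int n\<bar>"

text \<open>Each pair of residues is counted in both orders, so this is twice Shi's formula for the length.\<close>

definition inv_sum :: "aff \<Rightarrow> int" where
  "inv_sum w = (\<Sum>i\<in>{0..<int n}. \<Sum>j\<in>{0..<int n}. inv_term w i j)"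

lemma inv_term_periodic: 
  "inv_term w (i + int n) j = inv_term w i j" "inv_term w i (j + int n) = inv_term w i j"
proof -
  have p: "aff_perm_inv w (l + int n) = aff_perm_inv w l + int n" for l
    using aff_perm_inv_periodic[of w l 1] by simp
  have d: "(x - (y + int n)) div int n = (x - y) div int n - 1" for x y
    using div_mult_self1[of "int n" "x - y" "-1"] n_pos by (simp add: algebra_simps)
  have e: "(x + int n - y) div int n = (x - y) div int n + 1" for x y
    using div_mult_self1[of "int n" "x - y" "1"] n_pos by (simp add: algebra_simps)
  show "inv_term w (i + int n) j = inv_term w i j" "inv_term w i (j + int n) = inv_term w i j"
    by (simp_all add: inv_term_def p d e)
qed

text \<open>In the window starting at k the reflection with index k exchanges the first two
  positions and fixes the others, so no boundary is crossed.\<close>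

lemma inv_sum_shift:
  "inv_sum w = (\<Sum>(i, j)\<in>{int k..<int k + int n} \<times> {int k..<int k + int n}. inv_term w i j)"
proof -
  have "inv_sum w = (\<Sum>i\<in>{0..<int n}. \<Sum>j\<in>{int k..<int k + int n}. inv_term w i j)"
    unfolding inv_sum_def by (intro sum.cong refl periodic_sum_shift[symmetric] inv_term_periodic)
  also have "\<dots> = (\<Sum>i\<in>{int k..<int k + int n}. \<Sum>j\<in>{int k..<int k + int n}. inv_term w i j)"
    by (intro periodic_sum_shift[symmetric] sum.cong refl inv_term_periodic)
  also have "\<dots> = (\<Sum>(i, j)\<in>{int k..<int k + int n} \<times> {int k..<int k + int n}. inv_term w i j)"
    by (simp add: sum.cartesian_product)
  finally show ?thesis .
qed

lemma aff_swap_window: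
  assumes "k < n" "j \<in> {int k..<int k + int n}"
  shows "aff_swap k j = (if j = int k then int k + 1 else if j = int k + 1 then int k else j)"
proof -
  have m: "j mod int n = int k \<longleftrightarrow> j = int k"
  proof
    assume "j mod int n = int k"
    then have "(j - int k) mod int n = 0" by (metis mod_diff_left_eq diff_self mod_0)
    then show "j = int k" using assms by simp
  qed (use assms in simp)
  have m': "(j - 1) mod int n = int k \<longleftrightarrow> j = int k + 1"
  proof
    assume "(j - 1) mod int n = int k"
    then have *: "(j - 1 - int k) mod int n = 0" by (metis mod_diff_left_eq diff_self mod_0)
    show "j = int k + 1"
    proof (cases "j = int k")
      case True
      then have "(- 1) mod int n = 0" using * by simp
      then show ?thesis using n_ge_3 by (simp add: zmod_minus1)
    next
      case False
      then show ?thesis using * assms by simp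
    qed
  qed (use assms in simp)
  show ?thesis unfolding aff_swap_def m m' by simp
qed

lemma aff_swap_twice: "k < n \<Longrightarrow> aff_swap k (aff_swap k j) = j"
  using aff_perm_inv_refl_mult[of k "refl_mult k \<one>\<^bsub>\<W>\<^esub>" j]
  by (simp add: refl_mult_closed aff_perm_inv_refl_mult aff_perm_inv_one)

lemma aff_perm_inv_neq:
  assumes "w \<in> \<C>"
  shows "aff_perm_inv w (j + 1) \<noteq> aff_perm_inv w j"
proof
  assume "aff_perm_inv w (j + 1) = aff_perm_inv w j"
  then have "(j + 1) mod int n = j mod int n" using aff_perm_inv_cong_iff[OF assms] by metis
  then have "(j + 1 - j) mod int n = 0" by (metis mod_diff_cong diff_self mod_0)
  then show False using n_ge_3 by simp
qed

text \<open>After reindexing by the swap, it is the reference quotient of \<open>j - i\<close> that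
  changes. The swap preserves the order of every pair in the window except that of k and k + 1, so
  only these two ordered pairs contribute, each by 1 or -1.\<close>

lemma inv_sum_refl_mult:
  assumes "k < n" "w \<in> \<C>"
  shows "inv_sum (refl_mult k w) =
    inv_sum w + (if aff_perm_inv w (int k) < aff_perm_inv w (int k + 1) then 2 else - 2)"
proof -
  define R where "R = {int k..<int k + int n}"
  define S where "S = aff_swap k"
  define X where "X = aff_perm_inv w"
  define G where "G = (\<lambda>i j. \<bar>(X j - X i) div int n - (S j - S i) div int n\<bar>)"
  have S: "S j = (if j = int k then int k + 1 else if j = int k + 1 then int k else j)" if "j \<in> R" for j
    using aff_swap_window[OF assms(1)] that by (simp add: R_def S_def)
  have SS: "S (S j) = j" for j by (simp add: S_def aff_swap_twice assms)
  have SR: "S j \<in> R" if "j \<in> R" for j using S[OF that] that n_ge_3 by (auto simp: R_def)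
  have fin: "finite (R \<times> R)" by (simp add: R_def)
  have "inv_sum (refl_mult k w) =
      (\<Sum>(i, j)\<in>R \<times> R. \<bar>(X (S j) - X (S i)) div int n - (j - i) div int n\<bar>)"
    unfolding inv_sum_shift[of _ k] R_def[symmetric]
    by (intro sum.cong refl) (auto simp: inv_term_def aff_perm_inv_refl_mult assms X_def S_def)
  also have "\<dots> = (\<Sum>(i, j)\<in>R \<times> R. G i j)"
    by (rule sum.reindex_bij_witness[where i = "map_prod S S" and j = "map_prod S S"])
      (auto simp: SS SR G_def)
  finally have 1: "inv_sum (refl_mult k w) - inv_sum w = (\<Sum>(i, j)\<in>R \<times> R. G i j - inv_term w i j)"
    unfolding inv_sum_shift[of w k] R_def[symmetric] by (simp add: sum_subtractf case_prod_unfold)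
  have 2: "G i j = inv_term w i j"
    if "i \<in> R" "j \<in> R" "(i, j) \<noteq> (int k, int k + 1)" "(i, j) \<noteq> (int k + 1, int k)" for i j
  proof -
    have d: "x div int n = (if x < 0 then -1 else 0)" if "- int n < x" "x < int n" for x
    proof (cases "x < 0")
      case True
      then show ?thesis using that int_div_pos_eq[of x "int n" "- 1" "x + int n"] by simp
    qed (use that in simp)
    have "(S j - S i) div int n = (j - i) div int n"
    proof -
      have "- int n < S j - S i" "S j - S i < int n" using SR[OF that(1)] SR[OF that(2)] by (auto simp: R_def)
      moreover have "- int n < j - i" "j - i < int n" using that by (auto simp: R_def)
      moreover have "S j - S i < 0 \<longleftrightarrow> j - i < 0"
        using that by (auto simp: S R_def)
      ultimately show ?thesis by (simp add: d)
    qed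
    then show ?thesis by (simp add: G_def inv_term_def X_def)
  qed
  define d where "d = X (int k + 1) - X (int k)"
  have d0: "d \<noteq> 0" using aff_perm_inv_neq[OF assms(2), of "int k"] by (simp add: d_def X_def)
  have dn: "d mod int n \<noteq> 0"
  proof
    assume "d mod int n = 0"
    then have "X (int k + 1) mod int n = X (int k) mod int n" unfolding d_def by (metis mod_eq_dvd_iff mod_0_imp_dvd)
    then have "(int k + 1) mod int n = int k mod int n"
      using aff_perm_inv_cong_iff[OF assms(2)] by (simp add: X_def)
    then have "(int k + 1 - int k) mod int n = 0" by (metis mod_diff_cong diff_self mod_0)
    then show False using n_ge_3 by simp
  qed
  \<comment> \<open>As n does not divide d, the floor of -d/n is one below the negated floor of d/n.
    This makes the contributions of the two orders equal.\<close>
  have neg: "(X (int k) - X (int k + 1)) div int n = - (d div int n) - 1"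
    using zdiv_zminus1_eq_if[of "int n" d] dn n_pos by (simp add: d_def)
  have kR: "int k \<in> R" "int k + 1 \<in> R" using n_ge_3 by (auto simp: R_def)
  have m1: "(- 1) div int n = - 1" using n_ge_3 using int_div_pos_eq[of "- 1" "int n" "- 1" "int n - 1"] by simp
  have "(\<Sum>(i, j)\<in>R \<times> R. G i j - inv_term w i j) =
      (\<Sum>(i, j)\<in>{(int k, int k + 1), (int k + 1, int k)}. G i j - inv_term w i j)"
  proof (rule sum.mono_neutral_right)
    show "\<forall>p\<in>R \<times> R - {(int k, int k + 1), (int k + 1, int k)}. (case p of (i, j) \<Rightarrow> G i j - inv_term w i j) = 0"
      using 2 by (simp add: Ball_def)
  qed (use fin kR in auto)
  also have "\<dots> = 2 * (\<bar>d div int n + 1\<bar> - \<bar>d div int n\<bar>)"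
    using n_ge_3 by (simp add: G_def inv_term_def S kR X_def[symmetric] neg m1 d_def[symmetric])
  also have "\<dots> = (if d > 0 then 2 else - 2)"
    using d0 n_pos pos_imp_zdiv_nonneg_iff[of "int n" d] by auto
  finally show ?thesis using 1 by (simp add: d_def X_def)
qed

lemma inv_sum_one: "inv_sum \<one>\<^bsub>\<W>\<^esub> = 0"
  by (simp add: inv_sum_def inv_term_def aff_perm_inv_one)

lemma inv_sum_nonneg: "0 \<le> inv_sum w"
  unfolding inv_sum_def inv_term_def by (intro sum_nonneg) simp

lemma inv_sum_word_prod_le: "set ks \<subseteq> {..<n} \<Longrightarrow> inv_sum (word_prod n ks) \<le> 2 * int (length ks)"
  by (induction ks)
    (auto simp: word_prod_Nil inv_sum_one word_prod_Cons inv_sum_refl_mult word_prod_closed)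

lemma sum_aff_perm_inv:
  assumes "w \<in> \<C>"
  shows "(\<Sum>r=1..n. aff_perm_inv w (int r)) = (\<Sum>r=1..n. int r)"
proof -
  obtain \<gamma> \<sigma> where w: "w = (\<gamma>, \<sigma>)" by (cases w)
  have h: "\<gamma> \<in> coroot_lattice n" "\<sigma> permutes {1..n}" using assms by (simp_all add: w carrier_iff)
  have "(\<Sum>r=1..n. aff_perm_inv w (int r)) = (\<Sum>r=1..n. int (inv' \<sigma> r) - int n * \<gamma> r)"
    using aff_perm_inv_window[of _ \<gamma> \<sigma> 0] by (intro sum.cong) (simp_all add: w)
  also have "\<dots> = (\<Sum>r=1..n. int (inv' \<sigma> r)) - int n * (\<Sum>r=1..n. \<gamma> r)"
    by (simp add: sum_subtractf sum_distrib_left)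
  also have "\<dots> = (\<Sum>r=1..n. int r)"
    using sum.permute[OF permutes_inv[OF h(2)], of int] h(1) by (simp add: o_def coroot_lattice_def)
  finally show ?thesis .
qed

text \<open>From position 0 to position n the values grow by exactly n in n steps of at least 1, so
  every step is 1 and the permutation is a shift by its value at 0. The vanishing coordinate sum of
  the lattice rules out a nonzero shift.\<close>

lemma no_descent_imp_one:
  assumes w: "w \<in> \<C>" and asc: "\<And>k. k < n \<Longrightarrow> aff_perm_inv w (int k) < aff_perm_inv w (int k + 1)"
  shows "w = \<one>\<^bsub>\<W>\<^esub>"
proof -
  define X where "X = aff_perm_inv w"
  have lower: "X (int i) + (int j - int i) \<le> X (int j)" if "i \<le> j" "j \<le> n" for i j
    using that
  proof (induction j rule: nat_induct_at_least)
    case (Suc j)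
    then show ?case using asc[of j] by (simp add: X_def algebra_simps)
  qed simp
  have "X (int n) = X 0 + int n" using aff_perm_inv_periodic[of w 0 1] by (simp add: X_def)
  then have X: "X (int r) = X 0 + int r" if "r \<le> n" for r
    using lower[of 0 r] lower[of r n] that by simp
  have "(\<Sum>r=1..n. X (int r)) = (\<Sum>r=1..n. X 0 + int r)" by (rule sum.cong) (auto simp: X)
  then have "int n * X 0 = 0" using sum_aff_perm_inv[OF w] by (simp add: X_def sum.distrib)
  then have X0: "X 0 = 0" using n_pos by simp
  have "aff_perm_inv w j = aff_perm_inv \<one>\<^bsub>\<W>\<^esub> j" for j
  proof -
    obtain r m where r: "r \<in> {1..n}" "j = int r + int n * m" by (rule window_cases)
    then show ?thesis using aff_perm_inv_periodic[of w "int r" m] X[of r] X0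
      by (simp add: aff_perm_inv_one X_def)
  qed
  then show ?thesis using aff_perm_inv_inj w W.one_closed by blast
qed

lemma word_of_inv_sum:
  assumes "w \<in> \<C>"
  shows "\<exists>ks. 2 * int (length ks) = inv_sum w \<and> set ks \<subseteq> {..<n} \<and> word_prod n ks = w"
  using assms
proof (induction "nat (inv_sum w)" arbitrary: w rule: less_induct)
  case less
  show ?case
  proof (cases "w = \<one>\<^bsub>\<W>\<^esub>")
    case True
    then show ?thesis by (intro exI[of _ "[]"]) (simp add: word_prod_Nil inv_sum_one)
  next
    case False
    then obtain k where k: "k < n" "\<not> aff_perm_inv w (int k) < aff_perm_inv w (int k + 1)"
      using no_descent_imp_one[OF less.prems] by blast
    define v where "v = refl_mult k w"
    have v: "inv_sum v = inv_sum w - 2" "v \<in> \<C>" "refl_mult k v = w"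
      using k less.prems by (simp_all add: v_def inv_sum_refl_mult refl_mult_closed)
    then obtain ks where "2 * int (length ks) = inv_sum v" "set ks \<subseteq> {..<n}" "word_prod n ks = v"
      using less.hyps[of v] inv_sum_nonneg[of v] by auto
    then show ?thesis using v k by (intro exI[of _ "k # ks"]) (simp add: word_prod_Cons)
  qed
qed

text \<open>Removing descents one after another gives a word with half of \<open>inv_sum\<close> as
  length, and no word is shorter because each letter raises \<open>inv_sum\<close> by at most
  2.\<close>

lemma len_inv_sum:
  assumes "w \<in> \<C>"
  shows "2 * int (len n w) = inv_sum w"
proof -
  obtain ks where ks: "2 * int (length ks) = inv_sum w" "set ks \<subseteq> {..<n}" "word_prod n ks = w"
    using word_of_inv_sum[OF assms] by blast
  have "len n w = length ks" unfolding len_def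
  proof (rule Least_equality)
    fix l assume "\<exists>ls. length ls = l \<and> set ls \<subseteq> {..<n} \<and> word_prod n ls = w"
    then show "length ks \<le> l" using inv_sum_word_prod_le ks(1) by fastforce
  qed (use ks in blast)
  then show ?thesis using ks by simp
qed

lemma reduced_word:
  assumes "w \<in> \<C>"
  obtains ks where "length ks = len n w" "set ks \<subseteq> {..<n}" "word_prod n ks = w"
  using word_of_inv_sum[OF assms] len_inv_sum[OF assms] by (metis mult_cancel_left of_nat_eq_iff zero_neq_numeral)

lemma len_word_prod_le: "set ks \<subseteq> {..<n} \<Longrightarrow> len n (word_prod n ks) \<le> length ks"
  using inv_sum_word_prod_le[of ks] len_inv_sum[OF word_prod_closed, of ks] by simp

lemma len_one: "len n \<one>\<^bsub>\<W>\<^esub> = 0"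
  using len_inv_sum[OF W.one_closed] by (simp add: inv_sum_one)

definition descent :: "nat \<Rightarrow> aff \<Rightarrow> bool" where
  "descent k w \<longleftrightarrow> aff_perm_inv w (int k + 1) < aff_perm_inv w (int k)"

lemma len_refl_mult:
  assumes "k < n" "w \<in> \<C>"
  shows "int (len n (refl_mult k w)) = int (len n w) + (if descent k w then - 1 else 1)"
  using inv_sum_refl_mult[OF assms] len_inv_sum[OF assms(2)] len_inv_sum[OF refl_mult_closed[OF assms]]
    aff_perm_inv_neq[OF assms(2), of "int k"] by (auto simp: descent_def)

lemma len_refl_mult_descent: "\<lbrakk>k < n; w \<in> \<C>; descent k w\<rbrakk> \<Longrightarrow> len n w = Suc (len n (refl_mult k w))"
  using len_refl_mult[of k w] by simp

lemma len_refl_mult_ascent: "\<lbrakk>k < n; w \<in> \<C>; \<not> descent k w\<rbrakk> \<Longrightarrow> len n (refl_mult k w) = Suc (len n w)"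
  using len_refl_mult[of k w] by simp

lemma descent_refl_mult: "\<lbrakk>k < n; w \<in> \<C>\<rbrakk> \<Longrightarrow> descent k (refl_mult k w) \<longleftrightarrow> \<not> descent k w"
  using len_refl_mult[of k w] len_refl_mult[of k "refl_mult k w"] refl_mult_closed[of k w]
  by (auto split: if_splits)

lemma exists_descent: "\<lbrakk>w \<in> \<C>; w \<noteq> \<one>\<^bsub>\<W>\<^esub>\<rbrakk> \<Longrightarrow> \<exists>k<n. descent k w"
  using no_descent_imp_one[of w] aff_perm_inv_neq[of w] by (metis descent_def linorder_cases)

lemma len_eq_0_iff: "w \<in> \<C> \<Longrightarrow> len n w = 0 \<longleftrightarrow> w = \<one>\<^bsub>\<W>\<^esub>"
  using exists_descent len_refl_mult_descent len_one by (metis nat.distinct(1))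

lemma len_induct [consumes 1, case_names one refl]:
  assumes "w \<in> \<C>" "P \<one>\<^bsub>\<W>\<^esub>"
    and step: "\<And>k w. \<lbrakk>k < n; w \<in> \<C>; \<not> descent k w; P w\<rbrakk> \<Longrightarrow> P (refl_mult k w)"
  shows "P w"
  using assms(1)
proof (induction "len n w" arbitrary: w)
  case 0
  then show ?case using len_eq_0_iff assms(2) by simp
next
  case (Suc l)
  then have "w \<noteq> \<one>\<^bsub>\<W>\<^esub>" using len_one by auto
  then obtain k where k: "k < n" "descent k w" using exists_descent Suc by blast
  then have "P (refl_mult k w)"
    using Suc len_refl_mult_descent[of k w] by (simp add: refl_mult_closed)
  then show ?case
    using step[of k "refl_mult k w"] k Suc.prems by (simp add: refl_mult_closed descent_refl_mult)
qed

subsection \<open>Parity\<close>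

lemma sign_snd_refl_mult:
  assumes "k < n" "w \<in> \<C>"
  shows "sign (snd (refl_mult k w)) = - sign (snd w)"
proof -
  obtain \<gamma> \<sigma> where w: "w = (\<gamma>, \<sigma>)" by (cases w)
  have \<sigma>: "permutation \<sigma>" using assms by (auto simp: w carrier_iff permutation_permutes)
  have p: "permutation (Transposition.transpose a b)" for a b :: nat by (rule permutation_swap_id)
  show ?thesis using n_ge_3
    by (simp add: w refl_mult_def simple_refl_def mult_eq sign_compose \<sigma> p sign_swap_id)
qed

text \<open>Every simple reflection, including the affine one, has a transposition as finite part.
  Parity of length thereby becomes a homomorphism.\<close>

lemma aff_sign_eq:
  assumes "w \<in> \<C>"
  shows "aff_sign n w = sign (snd w)"
  using assms
proof (induction rule: len_induct)
  case one
  have "snd \<one>\<^bsub>\<W>\<^esub> = id" by (simp add: one_eq)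
  then show ?case by (simp add: aff_sign_def len_one)
qed (simp add: aff_sign_def sign_snd_refl_mult len_refl_mult_ascent)

lemma aff_sign_mult_inv:
  assumes "w \<in> \<C>" "v \<in> \<C>"
  shows "aff_sign n (w \<otimes>\<^bsub>\<W>\<^esub> inv\<^bsub>\<W>\<^esub> v) = aff_sign n w * aff_sign n v"
proof -
  have mult: "aff_sign n (x \<otimes>\<^bsub>\<W>\<^esub> y) = aff_sign n x * aff_sign n y" if "x \<in> \<C>" "y \<in> \<C>" for x y
  proof -
    have "permutation (snd x)" "permutation (snd y)"
      using that carrier_iff[of "fst x" "snd x"] carrier_iff[of "fst y" "snd y"]
      by (auto simp: permutation_permutes)
    then show ?thesis using that
      by (cases x, cases y) (simp add: aff_sign_eq, simp add: mult_eq sign_compose)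
  qed
  have "aff_sign n (inv\<^bsub>\<W>\<^esub> v) * aff_sign n v = 1"
    using mult[of "inv\<^bsub>\<W>\<^esub> v" v] assms by (simp add: aff_sign_def len_one)
  moreover have "aff_sign n v * aff_sign n v = 1" by (simp add: aff_sign_def flip: power_add mult_2)
  ultimately have "aff_sign n (inv\<^bsub>\<W>\<^esub> v) = aff_sign n v" by (metis mult.assoc mult.right_neutral mult.left_neutral)
  then show ?thesis using mult assms by simp
qed

end

subsection \<open>Reduced words\<close>

context affine_A
begin

section \<open>The cyclic Dynkin diagram and its braid relations\<close>

definition adjacent :: "nat \<Rightarrow> nat \<Rightarrow> bool" where
  "adjacent k l \<longleftrightarrow> (k + 1) mod n = l \<or> (l + 1) mod n = k"

lemma adjacent_sym: "adjacent k l \<longleftrightarrow> adjacent l k"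
  by (auto simp: adjacent_def)

lemma mod_add_one: "(j + 1) mod int n = (if j mod int n = int n - 1 then 0 else j mod int n + 1)"
proof -
  have "(j + 1) mod int n = (j mod int n + 1) mod int n" by (simp add: mod_add_left_eq)
  moreover have "0 \<le> j mod int n" "j mod int n < int n" using n_pos by simp_all
  ultimately show ?thesis by auto
qed

lemma mod_diff_one: "(j - 1) mod int n = (if j mod int n = 0 then int n - 1 else j mod int n - 1)"
proof -
  have "(j - 1) mod int n = (j mod int n - 1) mod int n" by (simp add: mod_diff_left_eq)
  moreover have "0 \<le> j mod int n" "j mod int n < int n" using n_pos by simp_all
  moreover have "(- 1) mod int n = int n - 1" using n_ge_3 by (simp add: zmod_minus1)
  ultimately show ?thesis by auto
qed

lemma Suc_mod_n: "k < n \<Longrightarrow> (k + 1) mod n = (if k = n - 1 then 0 else k + 1)"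
  using n_ge_3 by auto

lemma adjacent_iff:
  assumes "k < n" "l < n"
  shows "adjacent k l \<longleftrightarrow>
    int l = int k + 1 \<or> int k = int l + 1 \<or> (int k = int n - 1 \<and> int l = 0) \<or> (int l = int n - 1 \<and> int k = 0)"
  unfolding adjacent_def Suc_mod_n[OF assms(1)] Suc_mod_n[OF assms(2)] using assms n_ge_3 by auto

lemma aff_swap_mod:
  "aff_swap k j = (if j mod int n = int k then j + 1
    else if (if j mod int n = 0 then int n - 1 else j mod int n - 1) = int k then j - 1 else j)"
  by (simp only: aff_swap_def mod_diff_one)

text \<open>The two swaps act on three consecutive positions like the generators of the symmetric
  group on three letters; \<open>n_ge_3\<close> keeps the three residues distinct.\<close>

lemma aff_swap_triple:
  assumes "k < n" "l < n" "(k + 1) mod n = l" "p mod int n = int k"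
  shows "aff_swap k p = p + 1" "aff_swap k (p + 1) = p" "aff_swap k (p + 2) = p + 2"
    "aff_swap l p = p" "aff_swap l (p + 1) = p + 2" "aff_swap l (p + 2) = p + 1"
proof -
  have l: "int l = (if int k = int n - 1 then 0 else int k + 1)"
    using assms(1,3) Suc_mod_n[OF assms(1)] n_ge_3 by auto
  have m1: "(p + 1) mod int n = int l" using assms(4) l by (simp add: mod_add_one)
  have m2: "(p + 2) mod int n = (if int l = int n - 1 then 0 else int l + 1)"
    using mod_add_one[of "p + 1"] m1 by (simp add: add.assoc)
  show "aff_swap k p = p + 1" "aff_swap k (p + 1) = p" "aff_swap k (p + 2) = p + 2"
    "aff_swap l p = p" "aff_swap l (p + 1) = p + 2" "aff_swap l (p + 2) = p + 1"
    using n_ge_3 assms(1,2) l by (auto simp: aff_swap_mod assms(4) m1 m2 split: if_splits)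
qed

lemma aff_swap_braid:
  assumes "k < n" "l < n" "adjacent k l"
  shows "aff_swap k (aff_swap l (aff_swap k j)) = aff_swap l (aff_swap k (aff_swap l j))"
proof -
  have *: "aff_swap k (aff_swap l (aff_swap k j)) = aff_swap l (aff_swap k (aff_swap l j))"
    if kl: "k < n" "l < n" "(k + 1) mod n = l" for k l
  proof -
    note triple = aff_swap_triple[OF kl]
    consider "j mod int n = int k" | "(j - 1) mod int n = int k" | "(j - 2) mod int n = int k"
      | "j mod int n \<noteq> int k" "(j - 1) mod int n \<noteq> int k" "(j - 2) mod int n \<noteq> int k" by blast
    then show ?thesis
    proof cases
      case 1
      show ?thesis by (simp add: triple[OF 1])
    next
      case 2
      show ?thesis using triple[OF 2] by simp
    next
      case 3
      show ?thesis using triple[OF 3] by simp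
    next
      case 4
      have l: "int l = (int k + 1) mod int n" using kl(3) by (metis of_nat_1 of_nat_add of_nat_mod)
      have "i mod int n \<noteq> int l" if "(i - 1) mod int n \<noteq> int k" for i
      proof
        assume "i mod int n = int l"
        then have "(i - 1) mod int n = (int k + 1 - 1) mod int n" unfolding l by (rule mod_diff_cong) simp
        then show False using that kl(1) by simp
      qed
      from this[of j] this[of "j - 1"] have "j mod int n \<noteq> int l" "(j - 1) mod int n \<noteq> int l" using 4 by simp_all
      then show ?thesis using 4 by (simp add: aff_swap_def)
    qed
  qed
  from assms(3) show ?thesis
    unfolding adjacent_def using *[of k l] *[of l k] assms by auto
qed

lemma aff_swap_commute:
  assumes "k < n" "l < n" "k \<noteq> l" "\<not> adjacent k l"
  shows "aff_swap k (aff_swap l j) = aff_swap l (aff_swap k j)"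
proof -
  \<comment> \<open>\<open>M i a\<close> says that the swap with index i moves the positions of
    residue a. The moved residues i and i + 1 are permuted among themselves, and the sets for k and
    l are disjoint.\<close>
  define M where "M = (\<lambda>i a. a = int i \<or> (if a = 0 then int n - 1 else a - 1) = int i)"
  have fixed: "aff_swap i j = j" if "\<not> M i (j mod int n)" for i j
    using that by (auto simp: aff_swap_mod M_def)
  have moved: "M i (aff_swap i j mod int n)" if "M i (j mod int n)" "i < n" for i j
    using that n_ge_3 by (auto simp: aff_swap_mod M_def mod_add_one mod_diff_one split: if_splits)
  have disj: "\<not> (M k a \<and> M l a)" for a
    using assms n_ge_3 unfolding adjacent_iff[OF assms(1,2)] by (auto simp: M_def split: if_splits)
  show ?thesis
    using fixed moved disj assms by metis
qed

lemma refl_mult_braid: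
  assumes "k < n" "l < n" "adjacent k l" "w \<in> \<C>"
  shows "refl_mult k (refl_mult l (refl_mult k w)) = refl_mult l (refl_mult k (refl_mult l w))"
  by (rule aff_perm_inv_inj)
    (simp_all add: refl_mult_closed aff_perm_inv_refl_mult aff_swap_braid[OF assms(1-3)] assms)

lemma refl_mult_commute:
  assumes "k < n" "l < n" "k \<noteq> l" "\<not> adjacent k l" "w \<in> \<C>"
  shows "refl_mult k (refl_mult l w) = refl_mult l (refl_mult k w)"
  by (rule aff_perm_inv_inj)
    (simp_all add: refl_mult_closed aff_perm_inv_refl_mult aff_swap_commute[OF assms(1-4)] assms)

lemma descent_cong:
  assumes "j mod int n = int k"
  shows "descent k w \<longleftrightarrow> aff_perm_inv w (j + 1) < aff_perm_inv w j"
proof -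
  have j: "j = int k + int n * (j div int n)" using assms mult_div_mod_eq[of "int n" j] by simp
  show ?thesis
    using aff_perm_inv_periodic[of w "int k" "j div int n"] aff_perm_inv_periodic[of w "int k + 1" "j div int n"] j
    by (simp add: descent_def algebra_simps)
qed

text \<open>The values decrease along three consecutive positions. Sorting them takes three swaps,
  each of which removes a descent, and so strips a full braid from the left of w.\<close>

lemma two_descents_adjacent:
  assumes "k < n" "l < n" "adjacent k l" "w \<in> \<C>" "descent k w" "descent l w"
  obtains x where "x \<in> \<C>" "w = refl_mult k (refl_mult l (refl_mult k x))" "len n w = len n x + 3"
proof -
  have *: "\<exists>x\<in>\<C>. w = refl_mult k (refl_mult l (refl_mult k x)) \<and> len n w = len n x + 3"
    if kl: "k < n" "l < n" "(k + 1) mod n = l" "descent k w" "descent l w" for k l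
  proof -
    have m: "(int k + 1) mod int n = int l" using kl(3) by (metis of_nat_1 of_nat_add of_nat_mod)
    have d: "aff_perm_inv w (int k + 1) < aff_perm_inv w (int k)"
      "aff_perm_inv w (int k + 2) < aff_perm_inv w (int k + 1)"
      using kl(4,5) descent_cong[OF m, of w] by (simp_all add: descent_def add.assoc)
    have K: "int k mod int n = int k" using kl(1) by simp
    note S = aff_swap_triple[OF kl(1-3) K]
    define v1 v2 x where "v1 = refl_mult k w" and "v2 = refl_mult l v1" and "x = refl_mult k v2"
    have C: "v1 \<in> \<C>" "v2 \<in> \<C>" "x \<in> \<C>"
      using kl assms(4) by (simp_all add: v1_def v2_def x_def refl_mult_closed)
    have X1: "aff_perm_inv v1 j = aff_perm_inv w (aff_swap k j)" for j
      unfolding v1_def using kl assms(4) by (simp add: aff_perm_inv_refl_mult)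
    have X2: "aff_perm_inv v2 j = aff_perm_inv v1 (aff_swap l j)" for j
      unfolding v2_def using kl C by (simp add: aff_perm_inv_refl_mult)
    have "descent l v1" unfolding descent_cong[OF m] using d by (simp add: X1 S add.assoc)
    moreover have "descent k v2" using d by (simp add: descent_def X2 X1 S)
    ultimately have "len n w = len n x + 3"
      using len_refl_mult_descent[of k w] len_refl_mult_descent[of l v1] len_refl_mult_descent[of k v2] kl C assms(4)
      by (simp add: v1_def[symmetric] v2_def[symmetric] x_def[symmetric])
    moreover have "w = refl_mult k (refl_mult l (refl_mult k x))"
      using kl C assms(4) unfolding x_def v2_def v1_def by (simp add: refl_mult_closed)
    ultimately show ?thesis using C by blast
  qed
  from assms(3) have "\<exists>x\<in>\<C>. w = refl_mult k (refl_mult l (refl_mult k x)) \<and> len n w = len n x + 3"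
    unfolding adjacent_def
  proof
    assume "(l + 1) mod n = k"
    then show ?thesis using *[of l k] refl_mult_braid[OF assms(1-3)] assms by metis
  qed (use * assms in blast)
  then show ?thesis using that by blast
qed

lemma two_descents_commute:
  assumes "k < n" "l < n" "k \<noteq> l" "\<not> adjacent k l" "w \<in> \<C>" "descent k w" "descent l w"
  obtains x where "x \<in> \<C>" "w = refl_mult k (refl_mult l x)" "len n w = len n x + 2"
proof -
  have "aff_swap k (int l) = int l" "aff_swap k (int l + 1) = int l + 1"
    using assms(1-4) n_ge_3 unfolding adjacent_iff[OF assms(1,2)]
    by (auto simp: aff_swap_mod mod_add_one split: if_splits)
  then have "descent l (refl_mult k w)"
    using assms by (simp add: descent_def aff_perm_inv_refl_mult)
  then have "len n w = len n (refl_mult l (refl_mult k w)) + 2"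
    using len_refl_mult_descent[of k w] len_refl_mult_descent[of l "refl_mult k w"] assms refl_mult_closed by simp
  then show ?thesis using that[of "refl_mult l (refl_mult k w)"] assms by (simp add: refl_mult_closed)
qed

lemma descent_of_reduced:
  assumes "k < n" "w \<in> \<C>" "len n (refl_mult k w) = Suc (len n w)"
  shows "descent k (refl_mult k w)"
  using assms descent_refl_mult len_refl_mult_descent by fastforce

section \<open>Reduced words and Matsumoto's theorem\<close>

definition reduced :: "nat list \<Rightarrow> bool" where
  "reduced ks \<longleftrightarrow> set ks \<subseteq> {..<n} \<and> length ks = len n (word_prod n ks)"

lemma reduced_ConsD:
  assumes "reduced (k # ks)"
  shows "k < n" "reduced ks" "descent k (word_prod n (k # ks))"
proof -
  have k: "k < n" "set ks \<subseteq> {..<n}" using assms by (auto simp: reduced_def)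
  have c: "word_prod n ks \<in> \<C>" using k word_prod_closed by blast
  show "k < n" by (fact k)
  have "len n (word_prod n ks) \<le> length ks" using len_word_prod_le k by blast
  then have "len n (word_prod n ks) = length ks"
    using assms len_refl_mult[OF k(1) c] by (simp add: reduced_def word_prod_Cons split: if_splits)
  then show "reduced ks" "descent k (word_prod n (k # ks))"
    using k c assms descent_of_reduced by (simp_all add: reduced_def word_prod_Cons)
qed

text \<open>The first letters k and l of the two words are left descents of the same element, so it
  also has reduced words beginning with either side of the relation between k and l. These two words
  agree by that relation, and each agrees with one of the given words by induction on the
  tails.\<close>

lemma matsumoto:
  fixes T :: "nat \<Rightarrow> 'b \<Rightarrow> 'b"
  assumes braid: "\<And>k l b. \<lbrakk>k < n; l < n; adjacent k l\<rbrakk> \<Longrightarrow> T k (T l (T k b)) = T l (T k (T l b))"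
    and comm: "\<And>k l b. \<lbrakk>k < n; l < n; k \<noteq> l; \<not> adjacent k l\<rbrakk> \<Longrightarrow> T k (T l b) = T l (T k b)"
    and "reduced ks" "reduced ls" "word_prod n ks = word_prod n ls"
  shows "foldr T ks b = foldr T ls b"
  using assms(3-5)
proof (induction "length ks" arbitrary: ks ls)
  case 0
  then show ?case by (simp add: reduced_def)
next
  case (Suc m)
  define w where "w = word_prod n ks"
  have lw: "length ks = len n w" "length ls = len n w" using Suc.prems by (simp_all add: reduced_def w_def)
  obtain k us where ks: "ks = k # us" using Suc.hyps(2) by (cases ks) auto
  obtain l vs where ls: "ls = l # vs" using Suc.hyps(2) lw by (cases ls) auto
  have k: "k < n" "reduced us" "descent k w" using reduced_ConsD Suc.prems(1) by (auto simp: ks w_def)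
  have l: "l < n" "reduced vs" "descent l w" using reduced_ConsD Suc.prems(2,3) by (auto simp: ls w_def)
  have wu: "w = refl_mult k (word_prod n us)" "w = refl_mult l (word_prod n vs)"
    using Suc.prems(3) by (simp_all add: w_def word_prod_Cons ks ls)
  have cu: "word_prod n us \<in> \<C>" "word_prod n vs \<in> \<C>" using k(2) l(2) by (simp_all add: reduced_def word_prod_closed)
  have cw: "w \<in> \<C>" using wu cu k by (simp add: refl_mult_closed)
  have IH: "foldr T us b = foldr T us' b" if "reduced us'" "word_prod n us = word_prod n us'" for us'
    using Suc.hyps(1)[of us us'] Suc.hyps(2) k that by (simp add: ks)
  have IH': "foldr T vs b = foldr T vs' b" if "reduced vs'" "word_prod n vs = word_prod n vs'" for vs'
    using Suc.hyps(1)[of vs vs'] Suc.hyps(2) lw l that by (simp add: ks ls)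
  have eu: "word_prod n us = refl_mult k w" "word_prod n vs = refl_mult l w"
    using wu cu k l by (metis refl_mult_twice)+
  have lu: "length us = m" "length vs = m" "len n w = Suc m" using Suc.hyps(2) lw by (simp_all add: ks ls)
  consider "k = l" | "adjacent k l" | "k \<noteq> l" "\<not> adjacent k l" by blast
  then show ?case
  proof cases
    case 1
    then show ?thesis using IH[of vs] l eu by (simp add: ks ls)
  next
    case 2
    obtain x where x: "x \<in> \<C>" "w = refl_mult k (refl_mult l (refl_mult k x))" "len n w = len n x + 3"
      using two_descents_adjacent k l 2 cw by metis
    have x': "w = refl_mult l (refl_mult k (refl_mult l x))" using x refl_mult_braid k l 2 by simp
    obtain xs where xs: "length xs = len n x" "set xs \<subseteq> {..<n}" "word_prod n xs = x"
      using reduced_word[OF x(1)] by blast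
    have u: "word_prod n us = word_prod n (l # k # xs)" 
      unfolding eu x(2) word_prod_Cons xs(3) using k l x(1) by (simp add: refl_mult_closed)
    have v: "word_prod n vs = word_prod n (k # l # xs)" 
      unfolding eu x' word_prod_Cons xs(3) using k l x(1) by (simp add: refl_mult_closed)
    have "reduced (l # k # xs)" "reduced (k # l # xs)"
      using k l u v lu xs x(3) unfolding reduced_def by simp_all
    then show ?thesis using IH IH' u v braid[OF k(1) l(1) 2] by (simp add: ks ls)
  next
    case 3
    obtain x where x: "x \<in> \<C>" "w = refl_mult k (refl_mult l x)" "len n w = len n x + 2"
      using two_descents_commute k l 3 cw by metis
    have x': "w = refl_mult l (refl_mult k x)" using x refl_mult_commute k l 3 by simp
    obtain xs where xs: "length xs = len n x" "set xs \<subseteq> {..<n}" "word_prod n xs = x"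
      using reduced_word[OF x(1)] by blast
    have u: "word_prod n us = word_prod n (l # xs)" 
      unfolding eu x(2) word_prod_Cons xs(3) using k l x(1) by (simp add: refl_mult_closed)
    have v: "word_prod n vs = word_prod n (k # xs)" 
      unfolding eu x' word_prod_Cons xs(3) using k l x(1) by (simp add: refl_mult_closed)
    have "reduced (l # xs)" "reduced (k # xs)"
      using k l u v lu xs x(3) unfolding reduced_def by simp_all
    then show ?thesis using IH IH' u v comm[OF k(1) l(1) 3] by (simp add: ks ls)
  qed
qed

end

section \<open>Laurent polynomials\<close>

abbreviation q :: laurent where "q \<equiv> q_pow 1"

section \<open>Coefficients and the involution inverting q\<close>

lemma lookup_single_times:
  fixes p :: laurent
  shows "Poly_Mapping.lookup (Poly_Mapping.single a c * p) k = c * Poly_Mapping.lookup p (k - a)"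
proof -
  have "Sum_any (\<lambda>r. Poly_Mapping.lookup p r when k = l + r) = Poly_Mapping.lookup p (k - l)" for l
  proof -
    have "(k = l + r) \<longleftrightarrow> (k - l = r)" for r by auto
    then show ?thesis by simp
  qed
  then have "Poly_Mapping.lookup (Poly_Mapping.single a c * p) k =
      Sum_any (\<lambda>l. (c * Poly_Mapping.lookup p (k - l)) when a = l)"
    by (simp add: lookup_mult lookup_single mult_when when_mult)
  then show ?thesis by simp
qed

lemma lookup_q_pow_times: "Poly_Mapping.lookup (q_pow a * p) k = Poly_Mapping.lookup p (k - a)" for p :: laurent
  by (simp add: lookup_single_times)

lemma lookup_laurent_bar: "Poly_Mapping.lookup (laurent_bar p) k = Poly_Mapping.lookup p (- k)"
  by (simp add: laurent_bar_def map_key.rep_eq)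

lemma laurent_bar_add: "laurent_bar (a + b) = laurent_bar a + laurent_bar b"
  by (rule poly_mapping_eqI) (simp add: lookup_laurent_bar lookup_add)

lemma laurent_bar_diff: "laurent_bar (a - b) = laurent_bar a - laurent_bar b"
  by (rule poly_mapping_eqI) (simp add: lookup_laurent_bar lookup_minus)

lemma laurent_bar_zero: "laurent_bar 0 = 0"
  by (rule poly_mapping_eqI) (simp add: lookup_laurent_bar)

lemma laurent_bar_one: "laurent_bar 1 = 1"
  by (rule poly_mapping_eqI) (simp add: lookup_laurent_bar lookup_one)

lemma laurent_bar_single_times:
  "laurent_bar (Poly_Mapping.single a c * p) = Poly_Mapping.single (- a) c * laurent_bar p"
  by (rule poly_mapping_eqI) (simp add: lookup_laurent_bar lookup_single_times)

lemma laurent_bar_mult: "laurent_bar (a * b) = laurent_bar a * laurent_bar b"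
proof (induction a rule: update_induct)
  case const
  show ?case by (simp add: laurent_bar_zero)
next
  case (update f k c)
  have "Poly_Mapping.update k c f = f + Poly_Mapping.single k c"
    using update(1) by (intro poly_mapping_eqI) (auto simp: lookup_update lookup_add lookup_single in_keys_iff when_def)
  moreover have "laurent_bar (Poly_Mapping.single k c) = Poly_Mapping.single (- k) c"
    using laurent_bar_single_times[of k c 1] by (simp add: laurent_bar_one)
  ultimately show ?case
    using update(3) by (simp add: laurent_bar_add distrib_right laurent_bar_single_times)
qed

text \<open>The bound is on twice the degree, to match \<open>(len n v - len n w - 1) / 2\<close>; a negative \<open>d\<close> forces \<open>p = 0\<close>.\<close>

definition halfdeg :: "int \<Rightarrow> laurent \<Rightarrow> bool" where
  "halfdeg d p \<longleftrightarrow> (\<forall>k. Poly_Mapping.lookup p k \<noteq> 0 \<longrightarrow> 0 \<le> k \<and> 2 * k \<le> d)"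

lemma halfdeg_0: "halfdeg d 0"
  by (simp add: halfdeg_def)

lemma halfdeg_add: "halfdeg d p \<Longrightarrow> halfdeg d r \<Longrightarrow> halfdeg d (p + r)"
  unfolding halfdeg_def lookup_add by (metis add_0)

lemma halfdeg_minus: "halfdeg d p \<Longrightarrow> halfdeg d (- p)"
  by (simp add: halfdeg_def)

lemma halfdeg_sum: "(\<And>x. x \<in> A \<Longrightarrow> halfdeg d (f x)) \<Longrightarrow> halfdeg d (\<Sum>x\<in>A. f x)"
  by (induction A rule: infinite_finite_induct) (auto simp: halfdeg_0 halfdeg_add)

lemma halfdeg_mono: "halfdeg d p \<Longrightarrow> d \<le> e \<Longrightarrow> halfdeg e p"
  by (force simp: halfdeg_def)

lemma halfdeg_1: "0 \<le> d \<Longrightarrow> halfdeg d 1"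
  by (simp add: halfdeg_def lookup_one)

lemma halfdeg_q: "halfdeg d p \<Longrightarrow> halfdeg (d + 2) (q * p)"
  unfolding halfdeg_def lookup_q_pow_times by (smt (verit))

lemma halfdeg_mult:
  assumes "halfdeg d p" "halfdeg e r"
  shows "halfdeg (d + e) (p * r)"
  unfolding halfdeg_def
proof (intro allI impI)
  fix k assume "Poly_Mapping.lookup (p * r) k \<noteq> 0"
  then have "k \<in> Poly_Mapping.keys (p * r)" by (simp add: in_keys_iff)
  then obtain a b where "k = a + b" "a \<in> Poly_Mapping.keys p" "b \<in> Poly_Mapping.keys r"
    using keys_mult[of p r] by blast
  then show "0 \<le> k \<and> 2 * k \<le> d + e" using assms by (force simp: halfdeg_def in_keys_iff)
qed

text \<open>Duality makes the coefficients symmetric under \<open>k \<mapsto> b - a - k\<close>, and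
  the centre (b - a)/2 of this symmetry lies strictly above the support allowed by the
  bound.\<close>

lemma halfdeg_self_dual_zero:
  assumes "q_pow (- a) * laurent_bar p = q_pow (- b) * p" "halfdeg (b - a - 1) p"
  shows "p = 0"
proof (rule poly_mapping_eqI)
  fix k
  have "Poly_Mapping.lookup p k = Poly_Mapping.lookup p (b - a - k)"
    using arg_cong[OF assms(1), of "\<lambda>r. Poly_Mapping.lookup r (k - b)"]
    unfolding lookup_q_pow_times lookup_laurent_bar by (simp add: algebra_simps)
  then show "Poly_Mapping.lookup p k = Poly_Mapping.lookup 0 k"
    using assms(2) unfolding halfdeg_def lookup_zero by (smt (verit))
qed

lemma lookup_of_int_laurent: "Poly_Mapping.lookup (of_int c :: laurent) k = (if k = 0 then c else 0)"
  by (simp add: lookup_single flip: single_of_int)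

lemma laurent_of_poly_pCons: "laurent_of_poly (pCons c p) = of_int c + q * laurent_of_poly p"
  by (cases "pCons c p = 0") (simp_all add: laurent_of_poly_def map_poly_pCons)

lemma laurent_of_poly_0: "laurent_of_poly 0 = 0"
  by (simp add: laurent_of_poly_def)

lemma laurent_of_poly_1: "laurent_of_poly 1 = 1"
  by (simp add: laurent_of_poly_def)

lemma lookup_laurent_of_poly:
  "Poly_Mapping.lookup (laurent_of_poly p) k = (if 0 \<le> k then coeff p (nat k) else 0)"
proof (induction p arbitrary: k)
  case 0
  then show ?case by (simp add: laurent_of_poly_0)
next
  case (pCons c p)
  have "nat k = Suc (nat (k - 1))" if "0 < k" using that by simp
  then show ?case
    by (auto simp: laurent_of_poly_pCons lookup_add lookup_q_pow_times pCons.IH lookup_of_int_laurent coeff_pCons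
        split: nat.splits)
qed

lemma halfdeg_laurent_of_poly: "2 * int (degree p) \<le> d \<Longrightarrow> halfdeg d (laurent_of_poly p)"
  unfolding halfdeg_def lookup_laurent_of_poly
  by (auto split: if_splits dest!: le_degree)

section \<open>Evaluation at q = 1\<close>

definition eval_1 :: "laurent \<Rightarrow> int" where
  "eval_1 p = Sum_any (Poly_Mapping.lookup p)"

lemma eval_1_add: "eval_1 (a + b) = eval_1 a + eval_1 b"
  unfolding eval_1_def lookup_add by (rule Sum_any.distrib) simp_all

lemma eval_1_minus: "eval_1 (- a) = - eval_1 a"
  using eval_1_add[of a "- a"] by (simp add: eval_1_def)

lemma eval_1_single_times: "eval_1 (Poly_Mapping.single a c * p) = c * eval_1 p"
proof -
  have "Sum_any (\<lambda>k. c * Poly_Mapping.lookup p (k - a)) = Sum_any (\<lambda>k. c * Poly_Mapping.lookup p k)"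
    by (rule Sum_any.reindex_cong[where l = "\<lambda>k. k - a", symmetric])
      (auto simp: bij_def inj_def surj_def o_def intro: exI[of _ "_ + a"])
  also have "\<dots> = c * eval_1 p" unfolding eval_1_def by (rule Sum_any_right_distrib[symmetric]) simp
  moreover have "Poly_Mapping.lookup (Poly_Mapping.single a c * p) = (\<lambda>k. c * Poly_Mapping.lookup p (k - a))"
    by (simp add: fun_eq_iff lookup_single_times)
  ultimately show ?thesis by (simp add: eval_1_def)
qed

lemma eval_1_of_int_times: "eval_1 (of_int c * p) = c * eval_1 p"
  using eval_1_single_times[of 0 c p] by (simp flip: single_of_int)

lemma eval_1_0 [simp]: "eval_1 0 = 0"
  by (simp add: eval_1_def)

lemma eval_1_1 [simp]: "eval_1 1 = 1"
  using eval_1_single_times[of 0 1 1] by (simp add: eval_1_def lookup_one)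

lemma eval_1_laurent_of_poly: "eval_1 (laurent_of_poly p) = poly p 1"
proof (induction p)
  case (pCons c p)
  show ?case
    using eval_1_of_int_times[of c 1] eval_1_single_times[of 1 1 "laurent_of_poly p"]
    by (simp add: laurent_of_poly_pCons eval_1_add pCons.IH)
qed (simp add: laurent_of_poly_0)

section \<open>A module over the affine Hecke algebra\<close>

text \<open>Coordinate \<open>None\<close> belongs to the image of \<open>C\<close> at the identity, coordinate \<open>Some i\<close> to the image of
  \<open>C\<close> at \<open>w_int n i\<close>. The Kazhdan--Lusztig generator \<open>H\<^sub>s + 1\<close> acts by \<open>kl_op\<close>; its off-diagonal
  entry is \<open>1\<close> where the length increases and \<open>q\<close> where it decreases.\<close>

type_synonym kl_vec = "int option \<Rightarrow> laurent"

definition edge_wt :: "int \<Rightarrow> int \<Rightarrow> laurent" where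
  "edge_wt i j = (if \<bar>j\<bar> < \<bar>i\<bar> then 1 else q)"

context affine_A
begin

definition kl_op :: "nat \<Rightarrow> kl_vec \<Rightarrow> kl_vec" where
  "kl_op k b x = (case x of None \<Rightarrow> 0 | Some i \<Rightarrow>
    if i mod int n = int k
    then (q + 1) * b (Some i) + edge_wt i (i - 1) * b (Some (i - 1)) + edge_wt i (i + 1) * b (Some (i + 1))
      + (if i = 0 then b None else 0)
    else 0)"

definition hecke_op :: "nat \<Rightarrow> kl_vec \<Rightarrow> kl_vec" where
  "hecke_op k b x = kl_op k b x - b x"

lemma kl_op_None [simp]: "kl_op k b None = 0"
  by (simp add: kl_op_def)

lemma kl_op_Some:
  "kl_op k b (Some i) = (if i mod int n = int k
    then (q + 1) * b (Some i) + edge_wt i (i - 1) * b (Some (i - 1)) + edge_wt i (i + 1) * b (Some (i + 1))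
      + (if i = 0 then b None else 0)
    else 0)"
  by (simp add: kl_op_def)

lemma edge_wt_mult: "edge_wt i (i + 1) * edge_wt (i + 1) i = q" "edge_wt i (i - 1) * edge_wt (i - 1) i = q"
  by (auto simp: edge_wt_def)

lemma mod_neq_succ: "(i + 1) mod int n \<noteq> i mod int n" "(i - 1) mod int n \<noteq> i mod int n"
  using n_ge_3 by (auto simp: mod_add_one mod_diff_one)

text \<open>This fails for n = 2. It ensures that a generator acts at no more than one of the two
  neighbours of an index, which the relation in \<open>kl_op_braid\<close> rests on.\<close>

lemma mod_pred_neq_succ: "(i - 1) mod int n \<noteq> (i + 1) mod int n"
  using n_ge_3 by (auto simp: mod_add_one mod_diff_one split: if_splits)

lemma kl_op_diff: "kl_op k (\<lambda>x. b x - c x) x = kl_op k b x - kl_op k c x"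
  by (cases x) (simp_all add: kl_op_Some algebra_simps)

lemma kl_op_add: "kl_op k (\<lambda>x. b x + c x) x = kl_op k b x + kl_op k c x"
  by (cases x) (simp_all add: kl_op_Some algebra_simps)

lemma kl_op_scale: "kl_op k (\<lambda>x. a * b x) x = a * kl_op k b x"
  by (cases x) (simp_all add: kl_op_Some algebra_simps)

lemma kl_op_sq: "kl_op k (kl_op k b) x = (q + 1) * kl_op k b x"
proof (cases x)
  case (Some i)
  show ?thesis
  proof (cases "i mod int n = int k")
    case True
    have "kl_op k b (Some (i - 1)) = 0" "kl_op k b (Some (i + 1)) = 0"
      using mod_neq_succ[of i] by (simp_all add: kl_op_Some True)
    then show ?thesis using True by (simp add: Some kl_op_Some[of _ "kl_op k b" i])
  qed (simp add: Some kl_op_Some)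
qed simp

lemma mod_eq_int_imp_less: "i mod int n = int k \<Longrightarrow> k < n"
  using pos_mod_bound[of "int n" i] n_pos by simp

lemma adjacent_mod:
  assumes "i mod int n = int k" "l < n"
  shows "adjacent k l \<longleftrightarrow> (i + 1) mod int n = int l \<or> (i - 1) mod int n = int l"
  unfolding adjacent_iff[OF mod_eq_int_imp_less[OF assms(1)] assms(2)] mod_add_one mod_diff_one assms(1)
  using assms(2) mod_eq_int_imp_less[OF assms(1)] n_ge_3 by auto

text \<open>More than commutation: the product for commuting k and l is the Kazhdan-Lusztig element
  of their product, which does not survive in the quotient. Concretely, the output of
  \<open>kl_op l\<close> vanishes at every index that \<open>kl_op k\<close> reads.\<close>

lemma kl_op_commute:
  assumes "l < n" "k \<noteq> l" "\<not> adjacent k l"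
  shows "kl_op k (kl_op l b) x = 0"
proof (cases x)
  case (Some i)
  show ?thesis
  proof (cases "i mod int n = int k")
    case True
    then have "kl_op l b (Some i) = 0" "kl_op l b (Some (i - 1)) = 0" "kl_op l b (Some (i + 1)) = 0"
      using assms adjacent_mod[OF True, of l] by (simp_all add: kl_op_Some)
    then show ?thesis by (simp add: Some kl_op_Some[of _ "kl_op l b" i])
  qed (simp add: Some kl_op_Some)
qed simp

text \<open>The Temperley-Lieb relation; it expresses that \<open>C_s C_t C_s - q C_s\<close>, the
  Kazhdan-Lusztig element of the braid, acts by 0. From an index i only one neighbour has residue l,
  and the way there and back has weight q by \<open>edge_wt_mult\<close>.\<close>

lemma kl_op_braid:
  assumes "k < n" "l < n" "adjacent k l"
  shows "kl_op k (kl_op l (kl_op k b)) x = q * kl_op k b x"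
proof (cases x)
  case (Some i)
  show ?thesis
  proof (cases "i mod int n = int k")
    case True
    have lk: "l \<noteq> k" using assms n_ge_3 by (auto simp: adjacent_iff)
    define c where "c = kl_op k b"
    have c: "c None = 0" "c (Some (i - 1)) = 0" "c (Some (i + 1)) = 0"
      using mod_neq_succ[of i] by (simp_all add: c_def kl_op_Some True)
    have 0: "kl_op l c (Some i) = 0" using True lk by (simp add: kl_op_Some)
    consider "(i + 1) mod int n = int l" | "(i - 1) mod int n = int l"
      using adjacent_mod[OF True, of l] assms by blast
    then show ?thesis
    proof cases
      case 1
      have "(i + 2) mod int n \<noteq> int k" using mod_pred_neq_succ[of "i + 1"] True by (simp add: add.assoc)
      then have "c (Some (i + 2)) = 0" by (simp add: c_def kl_op_Some)
      then have "kl_op l c (Some (i + 1)) = edge_wt (i + 1) i * c (Some i)"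
        using 1 by (simp add: kl_op_Some[of _ c] c add.assoc)
      moreover have "kl_op l c (Some (i - 1)) = 0"
        using 1 mod_pred_neq_succ[of i] by (simp add: kl_op_Some)
      ultimately have "kl_op k (kl_op l c) (Some i) = q * c (Some i)"
        using True 0 by (simp add: kl_op_Some[of k "kl_op l c"] mult.assoc[symmetric] edge_wt_mult)
      then show ?thesis by (simp add: Some c_def)
    next
      case 2
      have "(i - 2) mod int n \<noteq> int k" using mod_pred_neq_succ[of "i - 1"] True by simp
      then have "c (Some (i - 2)) = 0" by (simp add: c_def kl_op_Some)
      then have "kl_op l c (Some (i - 1)) = edge_wt (i - 1) i * c (Some i)"
        using 2 by (simp add: kl_op_Some[of _ c] c)
      moreover have "kl_op l c (Some (i + 1)) = 0"
        using 2 mod_pred_neq_succ[of i] by (simp add: kl_op_Some)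
      ultimately have "kl_op k (kl_op l c) (Some i) = q * c (Some i)"
        using True 0 by (simp add: kl_op_Some[of k "kl_op l c"] mult.assoc[symmetric] edge_wt_mult)
      then show ?thesis by (simp add: Some c_def)
    qed
  qed (simp add: Some kl_op_Some)
qed simp

lemma hecke_op_eq: "hecke_op k b = (\<lambda>x. kl_op k b x - b x)"
  by (simp add: hecke_op_def fun_eq_iff)

lemma hecke_op_braid:
  assumes "k < n" "l < n" "adjacent k l"
  shows "hecke_op k (hecke_op l (hecke_op k b)) = hecke_op l (hecke_op k (hecke_op l b))"
proof
  fix x
  have "adjacent l k" using assms adjacent_sym by simp
  note braid = kl_op_braid[OF assms] kl_op_braid[OF assms(2,1) this]
  show "hecke_op k (hecke_op l (hecke_op k b)) x = hecke_op l (hecke_op k (hecke_op l b)) x"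
    unfolding hecke_op_eq kl_op_diff kl_op_sq braid by (simp add: distrib_right)
qed

lemma hecke_op_commute:
  assumes "k < n" "l < n" "k \<noteq> l" "\<not> adjacent k l"
  shows "hecke_op k (hecke_op l b) = hecke_op l (hecke_op k b)"
  using assms adjacent_sym[of k l]
  by (simp add: fun_eq_iff hecke_op_eq kl_op_diff kl_op_commute)

section \<open>Inverse operators and the duality of the module\<close>

definition hecke_op_inv :: "nat \<Rightarrow> kl_vec \<Rightarrow> kl_vec" where
  "hecke_op_inv k b x = q_pow (- 1) * kl_op k b x - b x"

lemma q_pow_mult: "q_pow a * (q_pow c * p) = q_pow (a + c) * p" for p :: laurent
  by (simp add: mult_single flip: mult.assoc)

text \<open>The quadratic relation gives the inverse of \<open>H_s\<close> as
  \<open>(H_s + 1) / q - 1\<close>.\<close>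

lemma hecke_op_inv_hecke_op: "hecke_op_inv k (hecke_op k b) = b"
proof
  fix x
  have "q_pow (- 1) * (q * p) = p" for p :: laurent by (simp add: q_pow_mult)
  then show "hecke_op_inv k (hecke_op k b) x = b x"
    by (simp add: hecke_op_inv_def hecke_op_eq kl_op_diff kl_op_sq algebra_simps)
qed

text \<open>The semilinear involution under which the basis vectors behave like the
  \<open>C_v\<close>, which pick up the power of q with exponent \<open>- len n v\<close>. The
  exponent \<open>\<bar>i\<bar> + 1\<close> is the length of \<open>w_int n i\<close>, by
  \<open>len_w_int\<close>.\<close>

definition bar_vec :: "kl_vec \<Rightarrow> kl_vec" where
  "bar_vec b x = (case x of None \<Rightarrow> laurent_bar (b None)
    | Some i \<Rightarrow> q_pow (- (\<bar>i\<bar> + 1)) * laurent_bar (b (Some i)))"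

text \<open>The module counterpart of the fact that the bar involution divides
  \<open>H_s + 1\<close> by q.\<close>

lemma bar_vec_kl_op: "bar_vec (kl_op k b) x = q_pow (- 1) * kl_op k (bar_vec b) x"
proof (cases x)
  case None
  then show ?thesis by (simp add: bar_vec_def laurent_bar_zero)
next
  case (Some i)
  \<comment> \<open>If j is closer to 0, the weight is 1 and the exponents differ by exactly the
    factor 1/q. If j is farther out, the weight q turns into 1/q, which makes up for the shift by
    one in the other direction.\<close>
  have e: "q_pow (- (\<bar>i\<bar> + 1)) * laurent_bar (edge_wt i j * p) =
      q_pow (- 1) * (edge_wt i j * (q_pow (- (\<bar>j\<bar> + 1)) * laurent_bar p))"
    if "\<bar>i\<bar> = \<bar>j\<bar> + 1 \<or> \<bar>j\<bar> = \<bar>i\<bar> + 1" for j p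
    using that by (auto simp: edge_wt_def laurent_bar_single_times q_pow_mult)
  have j: "\<bar>i\<bar> = \<bar>i - 1\<bar> + 1 \<or> \<bar>i - 1\<bar> = \<bar>i\<bar> + 1" "\<bar>i\<bar> = \<bar>i + 1\<bar> + 1 \<or> \<bar>i + 1\<bar> = \<bar>i\<bar> + 1" by auto
  have d: "q_pow (- (\<bar>i\<bar> + 1)) * laurent_bar ((q + 1) * p) = q_pow (- 1) * ((q + 1) * (q_pow (- (\<bar>i\<bar> + 1)) * laurent_bar p))" for p
  proof -
    have "- (\<bar>i\<bar> + 1) + - 1 = - 1 + - (\<bar>i\<bar> + 1)" by (rule add.commute)
    moreover have "- 1 + (1 + - (\<bar>i\<bar> + 1)) = - (\<bar>i\<bar> + 1)" by simp
    ultimately show ?thesis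
      by (simp only: distrib_right distrib_left laurent_bar_add laurent_bar_single_times q_pow_mult mult_1_left)
        (simp only: add.commute)
  qed
  have z: "q_pow (- (\<bar>i\<bar> + 1)) * laurent_bar (if i = 0 then p else 0) = q_pow (- 1) * (if i = 0 then laurent_bar p else 0)" for p
    by (simp add: laurent_bar_zero)
  have N: "bar_vec b None = laurent_bar (b None)" and S: "bar_vec b (Some j) = q_pow (- (\<bar>j\<bar> + 1)) * laurent_bar (b (Some j))" for j
    by (simp_all add: bar_vec_def)
  show ?thesis
  proof (cases "i mod int n = int k")
    case True
    have "bar_vec (kl_op k b) (Some i) = q_pow (- (\<bar>i\<bar> + 1)) * laurent_bar (kl_op k b (Some i))" by (simp add: bar_vec_def)
    also have "\<dots> = q_pow (- 1) * kl_op k (bar_vec b) (Some i)"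
      unfolding kl_op_Some N S if_P[OF True]
      by (simp only: laurent_bar_add distrib_left d e[OF j(1)] e[OF j(2)] z)
    finally show ?thesis by (simp add: Some)
  qed (simp add: Some kl_op_Some bar_vec_def laurent_bar_zero)
qed

lemma bar_vec_hecke_op: "bar_vec (hecke_op k b) = hecke_op_inv k (bar_vec b)"
proof
  fix x
  have "bar_vec (\<lambda>x. c x - b x) x = bar_vec c x - bar_vec b x" for c
    by (auto simp: bar_vec_def laurent_bar_diff right_diff_distrib split: option.split)
  then show "bar_vec (hecke_op k b) x = hecke_op_inv k (bar_vec b) x"
    by (simp add: hecke_op_eq hecke_op_inv_def bar_vec_kl_op)
qed


section \<open>Images of the standard basis in the module\<close>

definition base_vec :: kl_vec where
  "base_vec x = (if x = None then 1 else 0)"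

text \<open>The result of applying \<open>H_w\<close> to the generator. By \<open>matsumoto\<close>
  the choice of the reduced word is immaterial.\<close>

definition coords :: "aff \<Rightarrow> kl_vec" where
  "coords w = foldr hecke_op (SOME ks. reduced ks \<and> word_prod n ks = w) base_vec"

lemma coords_word_prod:
  assumes "reduced ks"
  shows "coords (word_prod n ks) = foldr hecke_op ks base_vec"
proof -
  let ?ls = "SOME ls. reduced ls \<and> word_prod n ls = word_prod n ks"
  have "reduced ?ls \<and> word_prod n ?ls = word_prod n ks"
    by (rule someI[of _ ks]) (simp add: assms)
  then show ?thesis unfolding coords_def
    using matsumoto[of hecke_op ?ls ks base_vec] hecke_op_braid hecke_op_commute assms by blast
qed

lemma coords_one: "coords \<one>\<^bsub>\<W>\<^esub> = base_vec"
  using coords_word_prod[of "[]"] by (simp add: reduced_def word_prod_Nil len_one)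

lemma coords_refl_mult:
  assumes "k < n" "w \<in> \<C>" "\<not> descent k w"
  shows "coords (refl_mult k w) = hecke_op k (coords w)"
proof -
  obtain ks where ks: "length ks = len n w" "set ks \<subseteq> {..<n}" "word_prod n ks = w"
    using reduced_word[OF assms(2)] by blast
  then have "reduced ks" "reduced (k # ks)"
    using assms len_refl_mult_ascent by (simp_all add: reduced_def word_prod_Cons)
  then show ?thesis using coords_word_prod[of ks] coords_word_prod[of "k # ks"] ks by (simp add: word_prod_Cons)
qed

lemma hecke_op_None: "hecke_op k b None = - b None"
  by (simp add: hecke_op_def)

lemma hecke_op_Some:
  "hecke_op k b (Some i) = (if i mod int n = int k
    then q * b (Some i) + edge_wt i (i - 1) * b (Some (i - 1)) + edge_wt i (i + 1) * b (Some (i + 1))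
      + (if i = 0 then b None else 0)
    else - b (Some i))"
  by (simp add: hecke_op_def kl_op_Some algebra_simps)

lemma coords_None: "w \<in> \<C> \<Longrightarrow> coords w None = (- 1) ^ len n w"
  by (induction rule: len_induct)
    (simp_all add: coords_one len_one base_vec_def coords_refl_mult hecke_op_None len_refl_mult_ascent)

text \<open>A letter moves the support by at most one index, and the line of indices is entered from
  \<open>None\<close> only at 0, which costs one letter more.\<close>

lemma coords_support:
  assumes "w \<in> \<C>" "coords w (Some i) \<noteq> 0"
  shows "\<bar>i\<bar> + 1 \<le> int (len n w)"
  using assms
proof (induction arbitrary: i rule: len_induct)
  case one
  then show ?case by (simp add: coords_one base_vec_def)
next
  case (refl k w)
  have l: "int (len n (refl_mult k w)) = int (len n w) + 1" using refl.hyps by (simp add: len_refl_mult_ascent)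
  have "hecke_op k (coords w) (Some i) \<noteq> 0" using refl by (simp add: coords_refl_mult)
  then have "coords w (Some i) \<noteq> 0 \<or> coords w (Some (i - 1)) \<noteq> 0 \<or> coords w (Some (i + 1)) \<noteq> 0 \<or> i = 0"
    by (auto simp: hecke_op_Some split: if_splits)
  then show ?case unfolding l using refl.IH[of i] refl.IH[of "i - 1"] refl.IH[of "i + 1"] by linarith
qed

subsection \<open>Specialization at \<open>q = 1\<close>\<close>

text \<open>For the half line h of indices at most 0, this is the sum up to index i of the entries
  of \<open>t_\<gamma> h - h\<close>, that is, its coefficient at the difference
  \<open>e_i - e_(i+1)\<close>.\<close>

definition z_total :: "int \<Rightarrow> (nat \<Rightarrow> int) \<Rightarrow> int" where
  "z_total i \<gamma> = (\<Sum>k=1..n. z_fun n i k (\<gamma> k))"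

text \<open>With E the floor term plus 1, the points \<open>k + n j\<close> up to i are those with
  \<open>j < E\<close>. The formula compares the half lines \<open>j < a\<close> and
  \<open>j < 0\<close> cut off at E, and so covers both signs of a at once.\<close>

lemma z_fun_eq:
  "z_fun n i k a = min a ((i - int k) div int n + 1) - min 0 ((i - int k) div int n + 1)"
proof -
  define e where "e = (i - int k) div int n"
  define f where "f = (\<lambda>j. int k + int n * j)"
  have inj: "inj f" using n_pos by (simp add: f_def inj_def)
  have le: "f j \<le> f l \<longleftrightarrow> j \<le> l" for j l using n_pos by (simp add: f_def)
  have le_i: "f j \<le> i \<longleftrightarrow> j \<le> e" for j
  proof -
    have m: "i - int k = int n * e + (i - int k) mod int n" by (simp add: e_def)
    have "0 \<le> (i - int k) mod int n" "(i - int k) mod int n < int n" using n_pos by simp_all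
    then have "f e \<le> i" "i < f (e + 1)" using m by (simp_all add: f_def algebra_simps)
    then show ?thesis using le[of j e] le[of "e + 1" j] by auto
  qed
  have S: "{..i} \<inter> {f x..f y} \<inter> range f = f ` {x..min y e}" for x y
    by (auto simp: le le_i)
  have C: "card ({..i} \<inter> {f x..f y} \<inter> range f) = nat (min y e - x + 1)" for x y
    unfolding S using inj by (subst card_image) (auto intro: inj_on_subset)
  have "f 0 = int k" "f (a - 1) = int k + (a - 1) * int n" "f a = int k + a * int n" "f (- 1) = int k - int n"
    by (simp_all add: f_def mult.commute)
  then show ?thesis
    using C[of 0 "a - 1"] C[of a "- 1"]
    unfolding z_fun_def e_def[symmetric] f_def[symmetric] by auto
qed

text \<open>The cut-off of \<open>z_fun_eq\<close> at i and at its two neighbours. The case -1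
  arises because the class of 0 is represented by n.\<close>

lemma floor_shift:
  assumes "1 \<le> r" "r \<le> n" "i mod int n = int c"
  shows "(i - int r) div int n + 1 = i div int n + (if r \<le> c then 1 else 0)"
    "(i + 1 - int r) div int n + 1 = i div int n + (if r \<le> c + 1 then 1 else 0)"
    "(i - 1 - int r) div int n + 1 = i div int n + (if r < c then 1 else if c = 0 \<and> r = n then - 1 else 0)"
proof -
  have c: "c < n" using mod_eq_int_imp_less[OF assms(3)] .
  have i: "i = int n * (i div int n) + int c" using mult_div_mod_eq[of "int n" i] assms(3) by simp
  have d: "(i + x) div int n = i div int n + y" if "int n * y \<le> int c + x" "int c + x < int n * y + int n" for x y
    by (rule int_div_pos_eq[of _ _ _ "int c + x - int n * y"]) (use that i in \<open>auto simp: algebra_simps\<close>)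
  show "(i - int r) div int n + 1 = i div int n + (if r \<le> c then 1 else 0)"
    using d[of 0 "- int r"] d[of "- 1" "- int r"] assms c by auto
  show "(i + 1 - int r) div int n + 1 = i div int n + (if r \<le> c + 1 then 1 else 0)"
    using d[of 0 "1 - int r"] d[of "- 1" "1 - int r"] assms c by (auto simp: algebra_simps)
  show "(i - 1 - int r) div int n + 1 = i div int n + (if r < c then 1 else if c = 0 \<and> r = n then - 1 else 0)"
    using d[of 0 "- 1 - int r"] d[of "- 1" "- 1 - int r"] d[of "- 2" "- 1 - int r"] assms c n_ge_3
    by (auto simp: algebra_simps)
qed

lemma z_total_split:
  assumes "a \<in> {1..n}" "b \<in> {1..n}" "a \<noteq> b"
  shows "z_total i \<gamma> = z_fun n i a (\<gamma> a) + z_fun n i b (\<gamma> b) + (\<Sum>r\<in>{1..n} - {a, b}. z_fun n i r (\<gamma> r))"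
proof -
  have "{1..n} = insert a (insert b ({1..n} - {a, b}))" using assms by auto
  then have "z_total i \<gamma> = (\<Sum>r\<in>insert a (insert b ({1..n} - {a, b})). z_fun n i r (\<gamma> r))"
    by (simp add: z_total_def)
  also have "\<dots> = z_fun n i a (\<gamma> a) + z_fun n i b (\<gamma> b) + (\<Sum>r\<in>{1..n} - {a, b}. z_fun n i r (\<gamma> r))"
    using assms(3) by (subst sum.insert, simp, simp, subst sum.insert) auto
  finally show ?thesis .
qed

text \<open>Exchanging the entries at i and i + 1 changes only the partial sum at i: it becomes the
  one at i - 1 plus the entry at i + 1. The extra -1 at \<open>i = 0\<close> is the displacement of
  the half line itself, which loses the entry at 0 and gains the one at 1.\<close>

lemma z_total_refl_mult:
  assumes "k < n"
  shows "z_total i (fst (refl_mult k w)) =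
    (if i mod int n = int k
     then z_total (i - 1) (fst w) + z_total (i + 1) (fst w) - z_total i (fst w) - (if i = 0 then 1 else 0)
     else z_total i (fst w))"
proof -
  define \<gamma> \<delta> where "\<gamma> = fst w" and "\<delta> = fst (refl_mult k w)"
  \<comment> \<open>The representatives in \<open>{1..n}\<close> of the classes of k and k + 1,
    whose coordinates the reflection exchanges.\<close>
  define a b where "a = (if k = 0 then n else k)" and "b = (if k = 0 then 1 else Suc k)"
  have ab: "a \<in> {1..n}" "b \<in> {1..n}" "a \<noteq> b" using assms n_ge_3 by (auto simp: a_def b_def)
  have \<delta>: "\<delta> a = \<gamma> b - (if k = 0 then 1 else 0)" "\<delta> b = \<gamma> a + (if k = 0 then 1 else 0)"
    "r \<noteq> a \<Longrightarrow> r \<noteq> b \<Longrightarrow> \<delta> r = \<gamma> r" for r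
    using n_ge_3 by (cases w; auto simp: \<delta>_def \<gamma>_def a_def b_def refl_mult_def simple_refl_def mult_eq inv_transpose_eq)+
  define c where "c = nat (i mod int n)"
  have c: "i mod int n = int c" using n_pos by (simp add: c_def)
  have cn: "c < n" using mod_eq_int_imp_less[OF c] .
  define e where "e = i div int n"
  have i0: "i = 0 \<longleftrightarrow> c = 0 \<and> e = 0" using mult_div_mod_eq[of "int n" i] c n_pos by (auto simp: e_def)
  have F: "(i - int r) div int n + 1 = e + (if r \<le> c then 1 else 0)"
    "(i + 1 - int r) div int n + 1 = e + (if r \<le> c + 1 then 1 else 0)"
    "(i - 1 - int r) div int n + 1 = e + (if r < c then 1 else if c = 0 \<and> r = n then - 1 else 0)"
    if "r \<in> {1..n}" for r
    using floor_shift[OF _ _ c, of r] that by (simp_all add: e_def)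
  have rest: "(\<Sum>r\<in>{1..n} - {a, b}. z_fun n i r (\<delta> r)) = (\<Sum>r\<in>{1..n} - {a, b}. z_fun n i r (\<gamma> r))"
    using \<delta> by (intro sum.cong) auto
  show ?thesis
  proof (cases "c = k")
    case True
    have "(\<Sum>r\<in>{1..n} - {a, b}. z_fun n (i - 1) r (\<gamma> r)) = (\<Sum>r\<in>{1..n} - {a, b}. z_fun n i r (\<gamma> r))"
      "(\<Sum>r\<in>{1..n} - {a, b}. z_fun n (i + 1) r (\<gamma> r)) = (\<Sum>r\<in>{1..n} - {a, b}. z_fun n i r (\<gamma> r))"
      using True by (auto intro!: sum.cong simp: z_fun_eq F a_def b_def split: if_splits)
    then obtain S where S: "(\<Sum>r\<in>{1..n} - {a, b}. z_fun n (i - 1) r (\<gamma> r)) = S"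
        "(\<Sum>r\<in>{1..n} - {a, b}. z_fun n (i + 1) r (\<gamma> r)) = S" "(\<Sum>r\<in>{1..n} - {a, b}. z_fun n i r (\<gamma> r)) = S"
      by metis
    show ?thesis
    proof (cases "k = 0")
      case k0: True
      have fl: "(i - int n) div int n + 1 = e" "(i - int 1) div int n + 1 = e"
          "(i + 1 - int n) div int n + 1 = e" "(i + 1 - int 1) div int n + 1 = e + 1"
          "(i - 1 - int n) div int n + 1 = e - 1" "(i - 1 - int 1) div int n + 1 = e"
        using F[of n] F[of 1] True k0 n_ge_3 by simp_all
      have "z_total i \<delta> = z_total (i - 1) \<gamma> + z_total (i + 1) \<gamma> - z_total i \<gamma> - (if e = 0 then 1 else 0)"
        unfolding z_total_split[OF ab] rest S \<delta> using k0 by (simp only: a_def b_def if_True z_fun_eq fl simp_thms) auto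
      then show ?thesis using True k0 i0 c by (simp add: \<gamma>_def \<delta>_def)
    next
      case k0: False
      have fl: "(i - int k) div int n + 1 = e + 1" "(i - int (Suc k)) div int n + 1 = e"
          "(i + 1 - int k) div int n + 1 = e + 1" "(i + 1 - int (Suc k)) div int n + 1 = e + 1"
          "(i - 1 - int k) div int n + 1 = e" "(i - 1 - int (Suc k)) div int n + 1 = e"
        using F[of k] F[of "Suc k"] True k0 assms by simp_all
      have "z_total i \<delta> = z_total (i - 1) \<gamma> + z_total (i + 1) \<gamma> - z_total i \<gamma>"
        unfolding z_total_split[OF ab] rest S \<delta> using k0 by (simp add: a_def b_def z_fun_eq fl del: of_nat_Suc)
      moreover have "i \<noteq> 0" using i0 True k0 by simp
      ultimately show ?thesis using True c by (simp add: \<gamma>_def \<delta>_def)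
    qed
  next
    case False
    obtain S where S: "(\<Sum>r\<in>{1..n} - {a, b}. z_fun n i r (\<gamma> r)) = S" by blast
    have "z_total i \<delta> = z_total i \<gamma>"
    proof (cases "k = 0")
      case k0: True
      have fl: "(i - int n) div int n + 1 = e" "(i - int 1) div int n + 1 = e + 1"
        using F[of n] F[of 1] False k0 cn n_ge_3 by simp_all
      show ?thesis
        unfolding z_total_split[OF ab] rest S \<delta> using k0 by (simp only: a_def b_def if_True z_fun_eq fl simp_thms)
    next
      case k0: False
      define N where "N = (i - int k) div int n + 1"
      have fl: "(i - int k) div int n + 1 = N" "(i - int (Suc k)) div int n + 1 = N"
        using F[of k] F[of "Suc k"] False k0 assms by (auto simp: N_def)
      show ?thesis
        unfolding z_total_split[OF ab] rest S \<delta> using k0 by (simp add: a_def b_def z_fun_eq fl del: of_nat_Suc)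
    qed
    then show ?thesis using False c by (simp add: \<gamma>_def \<delta>_def)
  qed
qed

lemma eval_1_edge_wt_times: "eval_1 (edge_wt i j * p) = eval_1 p"
  by (simp add: edge_wt_def eval_1_single_times)

lemma eval_1_hecke_op:
  "eval_1 (hecke_op k b (Some i)) = (if i mod int n = int k
    then eval_1 (b (Some i)) + eval_1 (b (Some (i - 1))) + eval_1 (b (Some (i + 1)))
      + (if i = 0 then eval_1 (b None) else 0)
    else - eval_1 (b (Some i)))"
  by (simp add: hecke_op_Some eval_1_add eval_1_minus eval_1_edge_wt_times eval_1_single_times)

lemma eval_1_sign: "eval_1 ((- 1) ^ m) = (- 1) ^ m"
  by (induction m) (simp_all add: eval_1_minus)

text \<open>The sign in i reverses the two neighbour terms and the sign in the length reverses all
  terms of the new vector; together they turn \<open>eval_1_hecke_op\<close> into the recursion of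
  \<open>z_total_refl_mult\<close>. The entry at \<open>None\<close>, a sign by
  \<open>coords_None\<close>, supplies the extra -1.\<close>

lemma eval_1_coords:
  assumes "w \<in> \<C>"
  shows "eval_1 (coords w (Some i)) = (- 1) ^ len n w * (- 1) ^ nat \<bar>i\<bar> * z_total i (fst w)"
  using assms
proof (induction arbitrary: i rule: len_induct)
  case one
  have "z_fun n i r 0 = 0" for r by (simp add: z_fun_eq)
  moreover have "fst \<one>\<^bsub>\<W>\<^esub> = (\<lambda>_. 0)" by (simp add: one_eq)
  ultimately show ?case by (simp add: coords_one base_vec_def z_total_def)
next
  case (refl k w)
  have s: "(- 1 :: int) ^ nat \<bar>i - 1\<bar> = - ((- 1) ^ nat \<bar>i\<bar>)" "(- 1 :: int) ^ nat \<bar>i + 1\<bar> = - ((- 1) ^ nat \<bar>i\<bar>)"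
    by (auto simp: minus_one_power_iff even_nat_iff)
  show ?case
    using refl.hyps
    by (simp add: coords_refl_mult eval_1_hecke_op refl.IH s len_refl_mult_ascent z_total_refl_mult
        coords_None eval_1_sign) (simp add: algebra_simps)
qed

subsection \<open>The elements \<open>w_int n i\<close>\<close>

definition res :: "int \<Rightarrow> nat" where
  "res i = nat (i mod int n)"

lemma int_res: "int (res i) = i mod int n"
  using n_pos by (simp add: res_def)

lemma res_less: "res i < n"
  using mod_eq_int_imp_less[of i "res i"] by (simp add: int_res)

lemma w_int_0: "w_int n 0 = refl_mult 0 \<one>\<^bsub>\<W>\<^esub>"
  by (simp add: w_int_def word_prod_Cons word_prod_Nil)

lemma w_int_outward:
  assumes "\<bar>j\<bar> = \<bar>i\<bar> + 1" "j = i + 1 \<or> j = i - 1"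
  shows "w_int n j = refl_mult (res j) (w_int n i)"
proof (cases "j > 0")
  case True
  then have "j = i + 1" "0 \<le> i" using assms by auto
  moreover from this have "rev [0..j] = j # rev [0..i]" by (simp add: upto_rec2)
  ultimately show ?thesis by (simp add: w_int_def word_prod_Cons res_def)
next
  case False
  then have j: "j = i - 1" "i \<le> 0" using assms by auto
  then have "[j..0] = j # [i..0]" by (simp add: upto_rec1)
  moreover have "i = 0 \<Longrightarrow> rev [0..i] = [i..0]" by simp
  ultimately show ?thesis using j by (cases "i = 0") (simp_all add: w_int_def word_prod_Cons res_def)
qed

lemma outward_induct [case_names zero outward]:
  assumes "P 0" "\<And>i j. \<lbrakk>\<bar>j\<bar> = \<bar>i\<bar> + 1; j = i + 1 \<or> j = i - 1; P i\<rbrakk> \<Longrightarrow> P j"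
  shows "P (i :: int)"
proof (induction "nat \<bar>i\<bar>" arbitrary: i)
  case 0
  then show ?case using assms(1) by simp
next
  case (Suc m)
  define h where "h = (if i > 0 then i - 1 else i + 1)"
  have "P h" using Suc by (intro Suc.hyps(1)) (auto simp: h_def)
  then show ?case using assms(2)[of i h] Suc(2) by (auto simp: h_def split: if_splits)
qed

lemma w_int_closed: "w_int n i \<in> \<C>"
  by (induction i rule: outward_induct)
    (simp_all add: w_int_0 w_int_outward refl_mult_closed res_less n_pos)

lemma z_total_eq_0:
  assumes "w \<in> \<C>" "int (len n w) < \<bar>i\<bar> + 1"
  shows "z_total i (fst w) = 0"
proof -
  have "coords w (Some i) = 0" using coords_support[OF assms(1), of i] assms(2) by linarith
  then show ?thesis using eval_1_coords[OF assms(1), of i] by simp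
qed

text \<open>That the defining word is reduced is certified by the specialization: a nonzero
  \<open>z_total\<close> at i forces the length to be at least \<open>\<bar>i\<bar> + 1\<close>, and
  each further letter adds at most 1. Hence both claims go through one induction.\<close>

lemma len_w_int_aux: "int (len n (w_int n i)) = \<bar>i\<bar> + 1 \<and> z_total i (fst (w_int n i)) = - 1"
proof (induction i rule: outward_induct)
  case zero
  have "z_total j (fst \<one>\<^bsub>\<W>\<^esub>) = 0" for j by (rule z_total_eq_0) (simp_all add: len_one)
  then have "z_total 0 (fst (w_int n 0)) = - 1" using z_total_refl_mult[of 0 0] n_pos by (simp add: w_int_0)
  moreover from this have "1 \<le> int (len n (w_int n 0))" using z_total_eq_0[OF w_int_closed, of 0 0] by linarith
  ultimately show ?case
    using len_refl_mult[of 0 "\<one>\<^bsub>\<W>\<^esub>"] n_pos by (simp add: w_int_0 len_one split: if_splits)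
next
  case (outward i j)
  \<comment> \<open>The other neighbour of j, lying farther out. Both j and h are out of reach for
    the length of \<open>w_int n i\<close>, so the recursion at j sees only the value at i.\<close>
  define h where "h = 2 * j - i"
  have h: "\<bar>h\<bar> = \<bar>i\<bar> + 2" using outward(1,2) by (auto simp: h_def)
  have "z_total j (fst (w_int n i)) = 0" "z_total h (fst (w_int n i)) = 0"
    using z_total_eq_0[OF w_int_closed] outward h by simp_all
  moreover have "j - 1 = i \<and> j + 1 = h \<or> j + 1 = i \<and> j - 1 = h" using outward(2) by (auto simp: h_def)
  moreover have "j \<noteq> 0" using outward(1) by auto
  ultimately have z: "z_total j (fst (w_int n j)) = - 1"
    using outward z_total_refl_mult[OF res_less, of j j "w_int n i"]
    by (auto simp: w_int_outward[OF outward(1,2)] int_res)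
  then have "\<bar>j\<bar> + 1 \<le> int (len n (w_int n j))" using z_total_eq_0[OF w_int_closed, of j j] by linarith
  then show ?case
    using z len_refl_mult[OF res_less w_int_closed, of j i] outward
    by (simp add: w_int_outward[OF outward(1,2)] split: if_splits)
qed

lemma len_w_int: "int (len n (w_int n i)) = \<bar>i\<bar> + 1"
  using len_w_int_aux by blast

lemma ascent_w_int:
  assumes "\<bar>j\<bar> = \<bar>i\<bar> + 1" "j = i + 1 \<or> j = i - 1"
  shows "\<not> descent (res j) (w_int n i)"
  using len_refl_mult[OF res_less w_int_closed, of j i] len_w_int[of i] len_w_int[of j] assms
  by (auto simp: w_int_outward[OF assms])

lemma coords_w_int: "coords (w_int n i) (Some i) = 1"
proof (induction i rule: outward_induct)
  case zero
  have "\<not> descent 0 \<one>\<^bsub>\<W>\<^esub>" by (simp add: descent_def aff_perm_inv_one)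
  then show ?case using n_pos by (simp add: w_int_0 coords_refl_mult coords_one hecke_op_Some base_vec_def)
next
  case (outward i j)
  define h where "h = 2 * j - i"
  have h: "\<bar>h\<bar> = \<bar>i\<bar> + 2" using outward(1,2) by (auto simp: h_def)
  have "coords (w_int n i) (Some j) = 0" "coords (w_int n i) (Some h) = 0"
    using coords_support[OF w_int_closed[of i]] outward h by (fastforce simp: len_w_int)+
  moreover have "j - 1 = i \<and> j + 1 = h \<or> j + 1 = i \<and> j - 1 = h" using outward(2) by (auto simp: h_def)
  moreover have "j \<noteq> 0" "edge_wt j i = 1" using outward(1) by (auto simp: edge_wt_def)
  ultimately show ?case
    using outward ascent_w_int[OF outward(1,2)]
    by (auto simp: w_int_outward[OF outward(1,2)] coords_refl_mult res_less w_int_closed hecke_op_Some int_res)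
qed

lemma w_int_descent_cases:
  obtains "i = 0" "w_int n i = refl_mult (res i) \<one>\<^bsub>\<W>\<^esub>"
  | j where "\<bar>i\<bar> = \<bar>j\<bar> + 1" "i = j + 1 \<or> i = j - 1" "w_int n i = refl_mult (res i) (w_int n j)"
proof (cases "i = 0")
  case True
  then show ?thesis using that(1) w_int_0 by (simp add: res_def)
next
  case False
  define j where "j = (if i > 0 then i - 1 else i + 1)"
  have "\<bar>i\<bar> = \<bar>j\<bar> + 1" "i = j + 1 \<or> i = j - 1" using False by (auto simp: j_def)
  then show ?thesis using that(2) w_int_outward by blast
qed

lemma descent_w_int: "descent (res i) (w_int n i)"
proof (cases i rule: w_int_descent_cases)
  case 1
  have "\<not> descent 0 \<one>\<^bsub>\<W>\<^esub>" by (simp add: descent_def aff_perm_inv_one)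
  then show ?thesis using 1 n_pos by (simp add: w_int_0 descent_refl_mult res_def)
next
  case (2 j)
  then show ?thesis using ascent_w_int descent_refl_mult[OF res_less w_int_closed] by metis
qed


text \<open>The hypotheses leave only \<open>i = 0\<close> with the indices 1 and -1, which length
  cannot tell apart. The value of \<open>z_total\<close> at j can: it is -1 for one element and 0
  for the other.\<close>

lemma w_int_neq:
  assumes "\<bar>j\<bar> = \<bar>i\<bar> + 1" "\<bar>h\<bar> = \<bar>i\<bar> + 1" "j = i + 1 \<or> j = i - 1" "h = i + 1 \<or> h = i - 1" "j \<noteq> h"
  shows "w_int n j \<noteq> w_int n h"
proof -
  have "j mod int n \<noteq> h mod int n" using mod_pred_neq_succ[of i] assms(3-5) by auto
  then have "z_total j (fst (w_int n h)) = z_total j (fst (w_int n i))"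
    using z_total_refl_mult[OF res_less[of h], of j "w_int n i"] by (simp add: w_int_outward[OF assms(2,4)] int_res)
  also have "\<dots> = 0" using z_total_eq_0[OF w_int_closed] assms(1) by (simp add: len_w_int)
  finally show ?thesis using len_w_int_aux[of j] by auto
qed

subsection \<open>Degree bound\<close>

text \<open>Exact in both directions: an inward j has weight 1 and leaves the doubled degree
  unchanged, while an outward j starts from a bound lower by 2, which the weight q restores.\<close>

lemma halfdeg_edge_wt:
  assumes "halfdeg (m - \<bar>j\<bar> - 2) p" "\<bar>i\<bar> = \<bar>j\<bar> + 1 \<or> \<bar>j\<bar> = \<bar>i\<bar> + 1"
  shows "halfdeg (m - \<bar>i\<bar> - 1) (edge_wt i j * p)"
proof (cases "\<bar>i\<bar> = \<bar>j\<bar> + 1")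
  case True
  then show ?thesis using assms(1) by (simp add: edge_wt_def)
next
  case False
  then show ?thesis using halfdeg_q[OF assms(1)] assms(2) by (auto simp: edge_wt_def algebra_simps)
qed

text \<open>In the recursion along \<open>w = s\<^sub>k x\<close> only the term \<open>q * coords x (Some i)\<close> can exceed the bound. It
  does not, because \<open>x\<close> has a left descent \<open>r\<close> with \<open>r \<noteq> k\<close>, so that this coordinate is, up to sign, the one of the
  shorter element \<open>s\<^sub>r x\<close>; the exception is \<open>x = w_int n j\<close> with \<open>j\<close> next to \<open>i\<close>, where two terms cancel.\<close>

lemma halfdeg_coords:
  assumes "w \<in> \<C>" "w \<noteq> w_int n i"
  shows "halfdeg (int (len n w) - \<bar>i\<bar> - 2) (coords w (Some i))"
  using assms
proof (induction "len n w" arbitrary: w i rule: less_induct)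
  case less
  show ?case
  proof (cases "w = \<one>\<^bsub>\<W>\<^esub>")
    case True
    then show ?thesis by (simp add: coords_one base_vec_def halfdeg_0)
  next
    case False
    then obtain k where k: "k < n" "descent k w" using exists_descent less.prems by blast
    define x where "x = refl_mult k w"
    have x: "x \<in> \<C>" "w = refl_mult k x" "\<not> descent k x" "len n w = Suc (len n x)"
      using k less.prems by (simp_all add: x_def refl_mult_closed descent_refl_mult len_refl_mult_descent)
    have IH: "halfdeg (int (len n y) - \<bar>j\<bar> - 2) (coords y (Some j))"
      if "y \<in> \<C>" "y \<noteq> w_int n j" "len n y \<le> len n x" for y j
      using less.hyps[of y j] that x by simp
    have cw: "coords w = hecke_op k (coords x)" using coords_refl_mult k x by simp
    show ?thesis
    proof (cases "i mod int n = int k")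
      case nk: False
      then have c: "coords w (Some i) = - coords x (Some i)" by (simp add: cw hecke_op_Some)
      show ?thesis
      proof (cases "x = w_int n i")
        case True
        then show ?thesis unfolding c using len_w_int[of i] x
          by (intro halfdeg_minus) (simp add: coords_w_int halfdeg_1)
      next
        case False
        then show ?thesis unfolding c using halfdeg_mono[OF IH[OF x(1) False]] x
          by (intro halfdeg_minus) simp
      qed
    next
      case ki: True
      have rk: "res i = k" using ki by (simp add: res_def)
      define t where "t = (\<lambda>j. edge_wt i j * coords x (Some j))"
      define B where "B = int (len n w) - \<bar>i\<bar> - 2"
      have c: "coords w (Some i) = q * coords x (Some i) + t (i - 1) + t (i + 1) + (if i = 0 then coords x None else 0)"
        using ki by (simp add: cw hecke_op_Some t_def)
      have t: "halfdeg B (t j)" if "j = i + 1 \<or> j = i - 1" "x \<noteq> w_int n j" for j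
      proof -
        have "\<bar>i\<bar> = \<bar>j\<bar> + 1 \<or> \<bar>j\<bar> = \<bar>i\<bar> + 1" using that(1) by auto
        then show ?thesis
          unfolding t_def B_def using halfdeg_edge_wt[OF IH[OF x(1) that(2)], of i] x(4) by simp
      qed
      have inward: "x \<noteq> w_int n j" if "\<bar>i\<bar> = \<bar>j\<bar> + 1" "j = i + 1 \<or> j = i - 1" for j
        using w_int_outward[of i j] that less.prems(2) x(2) rk by auto
      \<comment> \<open>This entry is a sign, hence of degree 0, and the bound at
        \<open>i = 0\<close> is \<open>len n x - 1\<close>, which is nonnegative exactly when x is
        not the identity.\<close>
      have None: "halfdeg B (if i = 0 then coords x None else 0)" if "x \<noteq> \<one>\<^bsub>\<W>\<^esub>"
      proof -
        have "0 < len n x" using len_eq_0_iff[OF x(1)] that by simp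
        then have "i = 0 \<Longrightarrow> 0 \<le> B" using x(4) by (simp add: B_def)
        then show ?thesis
          by (cases "even (len n x)") (auto simp: coords_None x(1) halfdeg_0 halfdeg_1 intro: halfdeg_minus)
      qed
      show ?thesis
      proof (cases "\<exists>j. \<bar>j\<bar> = \<bar>i\<bar> + 1 \<and> (j = i + 1 \<or> j = i - 1) \<and> x = w_int n j")
        case True
        then obtain j where j: "\<bar>j\<bar> = \<bar>i\<bar> + 1" "j = i + 1 \<or> j = i - 1" "x = w_int n j" by blast
        define h where "h = 2 * i - j"
        have h: "h = i + 1 \<or> h = i - 1" "h \<noteq> j" using j(2) by (auto simp: h_def)
        have "i mod int n \<noteq> j mod int n" using mod_neq_succ[of i] j(2) by auto
        \<comment> \<open>The last letter of \<open>w_int n j\<close> has a residue other than that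
          of i, so at i it only reverses the sign of the leading entry 1 of
          \<open>w_int n i\<close>.\<close>
        then have "coords x (Some i) = - 1"
          using ascent_w_int[OF j(1,2)]
          by (simp add: j(3) w_int_outward[OF j(1,2)] coords_refl_mult res_less w_int_closed hecke_op_Some int_res coords_w_int)
        moreover have "t j = q" using j by (simp add: t_def coords_w_int edge_wt_def)
        moreover have "t (i - 1) + t (i + 1) = t j + t h" using j(2) by (auto simp: h_def)
        ultimately have "coords w (Some i) = t h + (if i = 0 then coords x None else 0)"
          unfolding c by (simp add: algebra_simps)
        moreover have "x \<noteq> w_int n h"
        proof (cases "\<bar>h\<bar> = \<bar>i\<bar> + 1")
          case True
          then show ?thesis using w_int_neq[of j i h] j h by simp
        next
          case False
          then have "\<bar>h\<bar> \<noteq> \<bar>j\<bar>" using j by simp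
          then show ?thesis using len_w_int[of j] len_w_int[of h] j(3) by auto
        qed
        moreover have "x \<noteq> \<one>\<^bsub>\<W>\<^esub>" using len_w_int[of j] j(3) len_one by auto
        ultimately show ?thesis unfolding B_def[symmetric] using t[OF h(1)] None by (simp add: halfdeg_add)
      next
        case no: False
        show ?thesis
        proof (cases "x = \<one>\<^bsub>\<W>\<^esub>")
          case True
          have "i \<noteq> 0"
          proof
            assume "i = 0"
            then have "k = 0" using rk by (simp add: res_def)
            then show False using \<open>i = 0\<close> True x(2) less.prems(2) by (simp add: w_int_0)
          qed
          then show ?thesis unfolding c using True by (simp add: t_def coords_one base_vec_def halfdeg_0)
        next
          case x1: False
          have nj: "x \<noteq> w_int n j" if "j = i + 1 \<or> j = i - 1" for j
          proof -
            have "\<bar>i\<bar> = \<bar>j\<bar> + 1 \<or> \<bar>j\<bar> = \<bar>i\<bar> + 1" using that by auto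
            then show ?thesis using inward no that by blast
          qed
          obtain r where r: "r < n" "descent r x" using exists_descent x(1) x1 by blast
          have rk': "r \<noteq> k" using r x(3) by auto
          define y where "y = refl_mult r x"
          have y: "y \<in> \<C>" "x = refl_mult r y" "\<not> descent r y" "len n x = Suc (len n y)"
            using r x by (simp_all add: y_def refl_mult_closed descent_refl_mult len_refl_mult_descent)
          \<comment> \<open>Otherwise k is a descent of y. If k and r commute, moving k past r
            cancels it against y, so \<open>refl_mult k x\<close> is too short. If they are
            adjacent, r leads to a neighbour j of i: an outward j is excluded by \<open>nj\<close>,
            and an inward j permits a braid move.\<close>
          have "y \<noteq> w_int n i"
          proof
            assume yi: "y = w_int n i"
            have dk: "descent k y" using descent_w_int[of i] rk yi by simp
            have lx: "len n (refl_mult k x) = len n y + 2" using x y by simp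
            show False
            proof (cases "adjacent k r")
              case False
              have "refl_mult k x = refl_mult r (refl_mult k y)"
                using refl_mult_commute[OF k(1) r(1) _ False y(1)] rk' y(2) by simp
              then have "len n (refl_mult k x) \<le> Suc (len n (refl_mult k y))"
                using len_refl_mult[OF r(1) refl_mult_closed[OF k(1) y(1)]] by (simp split: if_splits)
              then show False using lx len_refl_mult_descent[OF k(1) y(1) dk] by simp
            next
              case True
              then obtain j where j: "j = i + 1 \<or> j = i - 1" "res j = r"
                using adjacent_mod[OF ki r(1)] by (metis int_res nat_int res_def)
              have xj: "x = w_int n j" if "\<bar>j\<bar> = \<bar>i\<bar> + 1"
                using w_int_outward[OF that j(1)] y(2) yi j(2) by simp
              have "\<bar>i\<bar> = \<bar>j\<bar> + 1 \<or> \<bar>j\<bar> = \<bar>i\<bar> + 1" using j(1) by auto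
              then have ji: "\<bar>i\<bar> = \<bar>j\<bar> + 1" using xj nj[OF j(1)] by blast
              then have wi: "y = refl_mult k (w_int n j)" using w_int_outward[of i j] j(1) rk yi by auto
              define z where "z = refl_mult r (w_int n j)"
              have z: "z \<in> \<C>" "w_int n j = refl_mult r z" "len n (w_int n j) = Suc (len n z)"
                using descent_w_int[of j] j(2) r(1) w_int_closed[of j]
                by (simp_all add: z_def refl_mult_closed len_refl_mult_descent)
              \<comment> \<open>The braid move brings k to the front of x, whereas k was chosen to
                be an ascent of x; this shows in the length of \<open>refl_mult k x\<close>.\<close>
              have "x = refl_mult k (refl_mult r (refl_mult k z))"
                unfolding y(2) wi z(2) using refl_mult_braid[OF k(1) r(1) True z(1)] by simp
              then have "refl_mult k x = refl_mult r (refl_mult k z)"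
                using z(1) k r by (simp add: refl_mult_closed)
              then have "len n (refl_mult k x) \<le> len n z + 2"
                using len_refl_mult[OF r(1) refl_mult_closed[OF k(1) z(1)]] len_refl_mult[OF k(1) z(1)]
                by (simp split: if_splits)
              then show False using lx z(3) len_w_int[of j] len_w_int[of i] yi ji by simp
            qed
          qed
          then have "halfdeg (int (len n y) - \<bar>i\<bar> - 2) (coords y (Some i))" using IH y by simp
          moreover have cy: "coords x (Some i) = - coords y (Some i)"
            using coords_refl_mult[OF r(1) y(1,3)] y(2) rk' ki by (simp add: hecke_op_Some)
          ultimately have "halfdeg B (q * coords x (Some i))"
            unfolding cy using halfdeg_q[OF halfdeg_minus, of "int (len n y) - \<bar>i\<bar> - 2"] x(4) y(4)
            by (simp add: B_def)
          then show ?thesis unfolding B_def[symmetric] c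
            using t nj None[OF x1] by (intro halfdeg_add) simp_all
        qed
      qed
    qed
  qed
qed

end

section \<open>Kazhdan--Lusztig bases\<close>

locale affine_hecke = hecke_algebra scale n H + affine_A n
  for scale :: "laurent \<Rightarrow> 'h::ring_1 \<Rightarrow> 'h" and n :: nat and H :: "aff \<Rightarrow> 'h"
begin

section \<open>Linear extension from the standard basis\<close>

definition lin_ext :: "(aff \<Rightarrow> laurent) \<Rightarrow> 'h \<Rightarrow> laurent" where
  "lin_ext f x = (\<Sum>b | representation (H ` \<C>) x b \<noteq> 0. representation (H ` \<C>) x b * f (inv_into \<C> H b))"

lemma in_span: "x \<in> span (H ` \<C>)"
  using span_H by blast

lemma lin_ext_superset:
  assumes "finite A" "{b. representation (H ` \<C>) x b \<noteq> 0} \<subseteq> A"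
  shows "lin_ext f x = (\<Sum>b\<in>A. representation (H ` \<C>) x b * f (inv_into \<C> H b))"
  unfolding lin_ext_def by (rule sum.mono_neutral_left) (use assms in auto)

lemma lin_ext_add: "lin_ext f (x + y) = lin_ext f x + lin_ext f y"
proof -
  let ?A = "{b. representation (H ` \<C>) x b \<noteq> 0} \<union> {b. representation (H ` \<C>) y b \<noteq> 0}"
  note r = representation_add[OF independent_H in_span in_span, of x y]
  have "finite ?A" by (simp add: finite_representation)
  then show ?thesis
    by (subst (1 2 3) lin_ext_superset[of ?A]) (auto simp: r distrib_right sum.distrib)
qed

lemma lin_ext_scale: "lin_ext f (scale a x) = a * lin_ext f x"
proof -
  let ?A = "{b. representation (H ` \<C>) x b \<noteq> 0}"
  note r = representation_scale[OF independent_H in_span, of a x]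
  have "finite ?A" by (simp add: finite_representation)
  then show ?thesis
    by (subst (1 2) lin_ext_superset[of ?A]) (auto simp: r sum_distrib_left mult.assoc)
qed

lemma lin_ext_H: "w \<in> \<C> \<Longrightarrow> lin_ext f (H w) = f w"
  using representation_basis[OF independent_H, of "H w"] lin_ext_superset[of "{H w}" "H w" f] inj_H
  by (auto simp: inv_into_f_f)

lemma lin_ext_0: "lin_ext f 0 = 0"
  by (simp add: lin_ext_def representation_zero)

lemma lin_ext_minus: "lin_ext f (- x) = - lin_ext f x"
  using lin_ext_add[of f x "- x"] by (simp add: lin_ext_0 minus_unique)

lemma lin_ext_diff: "lin_ext f (x - y) = lin_ext f x - lin_ext f y"
  using lin_ext_add[of f x "- y"] by (simp add: lin_ext_minus)

lemma lin_ext_sum: "lin_ext f (\<Sum>a\<in>A. g a) = (\<Sum>a\<in>A. lin_ext f (g a))"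
  by (induction A rule: infinite_finite_induct) (simp_all add: lin_ext_0 lin_ext_add)

lemma hecke_induct [case_names zero step]:
  assumes "Q 0" "\<And>c w x. w \<in> \<C> \<Longrightarrow> Q x \<Longrightarrow> Q (scale c (H w) + x)"
  shows "Q x"
  using in_span[of x] by (induction rule: span_induct_alt) (use assms in auto)

text \<open>The vector obtained by applying x to the generator of the module.\<close>

definition act :: "'h \<Rightarrow> kl_vec" where
  "act x y = lin_ext (\<lambda>w. coords w y) x"

lemma act_H: "w \<in> \<C> \<Longrightarrow> act (H w) = coords w"
  by (simp add: act_def lin_ext_H fun_eq_iff)

lemma act_lin: "act (scale c x + x') = (\<lambda>y. c * act x y + act x' y)"
  by (simp add: act_def lin_ext_add lin_ext_scale fun_eq_iff)

lemma act_0: "act 0 = (\<lambda>y. 0)"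
  by (simp add: act_def lin_ext_0 fun_eq_iff)

lemma hecke_op_lin: "hecke_op k (\<lambda>y. c * b y + b' y) = (\<lambda>y. c * hecke_op k b y + hecke_op k b' y)"
  by (simp add: hecke_op_eq kl_op_add kl_op_scale algebra_simps)

text \<open>Additivity of length makes this element fix each basis element from the left, hence all
  of the algebra; applying it to 1 identifies it.\<close>

lemma H_one: "H \<one>\<^bsub>\<W>\<^esub> = 1"
proof -
  have "H \<one>\<^bsub>\<W>\<^esub> * x = x" for x
  proof (induction x rule: hecke_induct)
    case (step c w x)
    have "H \<one>\<^bsub>\<W>\<^esub> * H w = H w" using H_mult[of "\<one>\<^bsub>\<W>\<^esub>" w] step(1) by (simp add: len_one)
    then show ?case using step(2) by (simp add: distrib_left scale_mult_right)
  qed simp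
  from this[of 1] show ?thesis by simp
qed

lemma not_descent_one: "\<not> descent k \<one>\<^bsub>\<W>\<^esub>"
  by (simp add: descent_def aff_perm_inv_one)

lemma len_simple_refl: "k < n \<Longrightarrow> len n (simple_refl n k) = 1"
  using len_refl_mult_ascent[of k "\<one>\<^bsub>\<W>\<^esub>"] not_descent_one
  by (simp add: refl_mult_def simple_refl_closed len_one)

lemma H_simple_refl_mult:
  assumes "k < n" "w \<in> \<C>" "\<not> descent k w"
  shows "H (simple_refl n k) * H w = H (refl_mult k w)"
  using H_mult[OF simple_refl_closed[OF assms(1)] assms(2)] len_refl_mult_ascent[OF assms]
  by (simp add: len_simple_refl assms(1) refl_mult_def)

lemma H_simple_refl_sq:
  assumes "k < n"
  shows "H (simple_refl n k) * H (simple_refl n k) =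
    scale q (H (simple_refl n k)) - H (simple_refl n k) + scale q 1"
  using H_quadratic[OF assms] scale_mult_right[of "H (simple_refl n k)" q 1]
  by (simp add: algebra_simps)

text \<open>For an ascent this is the recursion of \<open>coords\<close>. For a descent,
  \<open>H w\<close> is written as a product with a shorter basis element, and the quadratic
  relation of the algebra matches \<open>kl_op_sq\<close> in the module.\<close>

lemma act_mult:
  assumes "k < n"
  shows "act (H (simple_refl n k) * x) = hecke_op k (act x)"
proof (induction x rule: hecke_induct)
  case zero
  show ?case by (simp add: act_0 hecke_op_eq fun_eq_iff kl_op_def split: option.split)
next
  case (step c w x)
  have "act (H (simple_refl n k) * H w) = hecke_op k (act (H w))"
  proof (cases "descent k w")
    case False
    then show ?thesis using assms step(1)
      by (simp add: H_simple_refl_mult act_H refl_mult_closed coords_refl_mult)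
  next
    case True
    define v where "v = refl_mult k w"
    have v: "v \<in> \<C>" "\<not> descent k v" "w = refl_mult k v"
      using True assms step(1) by (simp_all add: v_def refl_mult_closed descent_refl_mult)
    have Hw: "H w = H (simple_refl n k) * H v" using H_simple_refl_mult[OF assms v(1,2)] v(3) by simp
    have cw: "coords w = hecke_op k (coords v)" using coords_refl_mult[OF assms v(1,2)] v(3) by simp
    have "H (simple_refl n k) * H w = scale q (H w) - H w + scale q (H v)"
      unfolding Hw mult.assoc[symmetric] H_simple_refl_sq[OF assms]
      by (simp add: distrib_right left_diff_distrib scale_mult_left)
    then have "act (H (simple_refl n k) * H w) y = q * coords w y - coords w y + q * coords v y" for y
      by (simp add: act_def lin_ext_add lin_ext_diff lin_ext_scale lin_ext_H step(1) v(1))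
    moreover have "hecke_op k (coords w) y = q * coords w y - coords w y + q * coords v y" for y
      by (simp add: cw hecke_op_eq kl_op_diff kl_op_sq algebra_simps)
    ultimately show ?thesis by (simp add: fun_eq_iff act_H step(1))
  qed
  then show ?case
    using step(2) by (simp add: distrib_left scale_mult_right act_lin hecke_op_lin)
qed

lemma bar_vec_lin: "bar_vec (\<lambda>y. c * b y + b' y) = (\<lambda>y. laurent_bar c * bar_vec b y + bar_vec b' y)"
  by (auto simp: fun_eq_iff bar_vec_def laurent_bar_add laurent_bar_mult algebra_simps split: option.split)

text \<open>The generator is fixed by \<open>bar_vec\<close>. In the induction, the bar of
  \<open>H_s\<close> is the inverse of \<open>H_s\<close>, so it acts by the inverse operator, which
  is also what \<open>bar_vec\<close> produces from \<open>hecke_op\<close>.\<close>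

lemma act_bar:
  assumes "bar_involution bar"
  shows "act (bar x) = bar_vec (act x)"
proof -
  have add: "bar (x + y) = bar x + bar y" and mult: "bar (x * y) = bar x * bar y"
    and scale: "bar (scale a x) = scale (laurent_bar a) (bar x)" for x y a
    using assms by (auto simp: bar_involution_def)
  have inv: "bar (H w) * H (inv\<^bsub>\<W>\<^esub> w) = 1" "H (inv\<^bsub>\<W>\<^esub> w) * bar (H w) = 1" if "w \<in> \<C>" for w
    using assms that by (auto simp: bar_involution_def)
  have H: "act (bar (H w)) = bar_vec (coords w)" if "w \<in> \<C>" for w
    using that
  proof (induction rule: len_induct)
    case one
    have "bar (H \<one>\<^bsub>\<W>\<^esub>) = H \<one>\<^bsub>\<W>\<^esub>" using inv(1)[of "\<one>\<^bsub>\<W>\<^esub>"] by (simp add: H_one)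
    moreover have "bar_vec base_vec = base_vec"
      by (auto simp: fun_eq_iff bar_vec_def base_vec_def laurent_bar_one laurent_bar_zero split: option.split)
    ultimately show ?case by (simp add: act_H coords_one)
  next
    case (refl k w)
    let ?s = "simple_refl n k"
    have e: "bar (H (refl_mult k w)) = bar (H ?s) * bar (H w)"
      using H_simple_refl_mult[OF refl(1-3)] mult by metis
    have "H ?s * (bar (H ?s) * bar (H w)) = bar (H w)"
      using inv(2)[OF simple_refl_closed] refl(1) by (simp add: inv_simple_refl flip: mult.assoc)
    then have "hecke_op k (act (bar (H (refl_mult k w)))) = act (bar (H w))"
      using act_mult[OF refl(1)] e by metis
    then have "act (bar (H (refl_mult k w))) = hecke_op_inv k (act (bar (H w)))"
      by (metis hecke_op_inv_hecke_op)
    then show ?case using refl by (simp add: coords_refl_mult bar_vec_hecke_op)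
  qed
  show ?thesis
  proof (induction x rule: hecke_induct)
    case zero
    have "bar 0 = 0" using add[of 0 0] by simp
    then show ?case by (auto simp: act_0 fun_eq_iff bar_vec_def laurent_bar_zero split: option.split)
  next
    case (step c w x)
    then show ?case by (simp add: add scale act_lin bar_vec_lin H act_H)
  qed
qed

section \<open>Bruhat intervals and the vanishing argument\<close>

lemma bruhat_le_imp:
  assumes "bruhat_le n u v"
  shows "u \<in> \<C>" "u = v \<or> len n u < len n v"
proof -
  show "u \<in> \<C>" using assms by (simp add: bruhat_le_def)
  have "(bruhat_step n)\<^sup>*\<^sup>* u v" using assms by (simp add: bruhat_le_def)
  then show "u = v \<or> len n u < len n v"
    by (induction rule: rtranclp_induct) (auto simp: bruhat_step_def)
qed

lemma bruhat_le_refl: "v \<in> \<C> \<Longrightarrow> bruhat_le n v v"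
  by (simp add: bruhat_le_def)

lemma finite_bruhat_le: "finite {u. bruhat_le n u v}"
proof (rule finite_subset)
  show "finite (word_prod n ` {ks. set ks \<subseteq> {..<n} \<and> length ks \<le> len n v})"
    by (intro finite_imageI finite_lists_length_le) simp
  show "{u. bruhat_le n u v} \<subseteq> word_prod n ` {ks. set ks \<subseteq> {..<n} \<and> length ks \<le> len n v}"
  proof
    fix u assume "u \<in> {u. bruhat_le n u v}"
    then have u: "u \<in> \<C>" "len n u \<le> len n v" using bruhat_le_imp[of u v] by auto
    obtain ks where "length ks = len n u" "set ks \<subseteq> {..<n}" "word_prod n ks = u"
      using reduced_word[OF u(1)] by blast
    then show "u \<in> word_prod n ` {ks. set ks \<subseteq> {..<n} \<and> length ks \<le> len n v}" using u by force
  qed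
qed

text \<open>By self-duality together with the degree bound, the module sees only the elements of the
  Kazhdan--Lusztig basis at the identity and at the \<open>w_int n i\<close>.\<close>

lemma act_kl_basis:
  assumes bar: "bar_involution bar" and kl: "kl_basis bar P C" and v: "v \<in> \<C>"
  shows "act (C v) (Some i) = (if v = w_int n i then 1 else 0)"
proof -
  define S where "S = {w. bruhat_le n w v}"
  have Cv: "C v = (\<Sum>w\<in>S. scale (laurent_of_poly (P w v)) (H w))" and Pv: "P v v = 1"
    and dual: "bar (C v) = scale (q_pow (- int (len n v))) (C v)"
    using kl v by (auto simp: kl_basis_def S_def)
  have deg: "2 * int (degree (P w v)) \<le> int (len n v) - int (len n w) - 1" if "w \<in> S" "w \<noteq> v" for w
  proof -
    have "real (degree (P w v)) \<le> (real (len n v) - real (len n w) - 1) / 2"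
      using kl[unfolded kl_basis_def] v that unfolding S_def by blast
    then have "real_of_int (2 * int (degree (P w v))) \<le> real_of_int (int (len n v) - int (len n w) - 1)"
      by simp
    then show ?thesis by (simp only: of_int_le_iff)
  qed
  have vS: "v \<in> S" and fin: "finite S" using bruhat_le_refl[OF v] finite_bruhat_le by (auto simp: S_def)
  have S: "w \<in> \<C>" "w = v \<or> len n w < len n v" if "w \<in> S" for w
    using bruhat_le_imp that by (auto simp: S_def)
  have X: "act (C v) (Some i) = (\<Sum>w\<in>S. laurent_of_poly (P w v) * coords w (Some i))"
    unfolding Cv act_def lin_ext_sum using S by (intro sum.cong) (simp_all add: lin_ext_scale lin_ext_H)
  show ?thesis
  proof (cases "v = w_int n i")
    case True
    have "(\<Sum>w\<in>S. laurent_of_poly (P w v) * coords w (Some i)) =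
        (\<Sum>w\<in>{v}. laurent_of_poly (P w v) * coords w (Some i))"
    proof (rule sum.mono_neutral_right)
      show "\<forall>w\<in>S - {v}. laurent_of_poly (P w v) * coords w (Some i) = 0"
      proof
        fix w assume "w \<in> S - {v}"
        then have w: "w \<in> \<C>" "len n w < len n v" using S[of w] by auto
        then have "int (len n w) < \<bar>i\<bar> + 1" using len_w_int[of i] True by simp
        then have "coords w (Some i) = 0" using coords_support[OF w(1), of i] by linarith
        then show "laurent_of_poly (P w v) * coords w (Some i) = 0" by simp
      qed
    qed (use fin vS in auto)
    then show ?thesis unfolding X using True Pv by (simp add: laurent_of_poly_1 coords_w_int)
  next
    case False
    \<comment> \<open>One less than the length difference of v and \<open>w_int n i\<close>, as
      needed for self-duality. The summand at v meets it by \<open>halfdeg_coords\<close>, the one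
      at \<open>w_int n i\<close> by the bound on \<open>P\<close>; for all others the two bounds
      add up to d - 1.\<close>
    define d where "d = int (len n v) - (\<bar>i\<bar> + 1) - 1"
    have "halfdeg d (laurent_of_poly (P w v) * coords w (Some i))" if w: "w \<in> S" for w
    proof (cases "w = v")
      case True
      then show ?thesis using halfdeg_coords[OF v False] by (simp add: Pv laurent_of_poly_1 d_def algebra_simps)
    next
      case wv: False
      note p = halfdeg_laurent_of_poly[OF deg[OF w wv]]
      show ?thesis
      proof (cases "w = w_int n i")
        case True
        then show ?thesis using p len_w_int[of i] by (simp add: coords_w_int d_def algebra_simps)
      next
        case False
        then show ?thesis
          using halfdeg_mono[OF halfdeg_mult[OF p halfdeg_coords[OF S(1)[OF w] False]], of d] by (simp add: d_def)
      qed
    qed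
    then have deg_act: "halfdeg d (act (C v) (Some i))" unfolding X by (rule halfdeg_sum)
    have "q_pow (- (\<bar>i\<bar> + 1)) * laurent_bar (act (C v) (Some i)) =
        q_pow (- int (len n v)) * act (C v) (Some i)"
    proof -
      have "bar_vec (act (C v)) (Some i) = q_pow (- int (len n v)) * act (C v) (Some i)"
        unfolding act_bar[OF bar, symmetric] dual by (simp add: act_def lin_ext_scale)
      then show ?thesis by (simp add: bar_vec_def)
    qed
    from halfdeg_self_dual_zero[OF this deg_act[unfolded d_def]] show ?thesis using False by simp
  qed
qed

text \<open>Applying \<open>act\<close> to the expansion of \<open>H w\<close> leaves only the
  summand at \<open>w_int n i\<close>. If that element is not below w, the coordinate is an empty
  sum and the polynomial is 0 by convention.\<close>

lemma inverse_kl_poly_coords: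
  assumes "bar_involution bar" "kl_basis bar P C" "inverse_kl_polys C m" "w \<in> \<C>"
  shows "coords w (Some i) =
    of_int (aff_sign n (w \<otimes>\<^bsub>\<W>\<^esub> inv\<^bsub>\<W>\<^esub> (w_int n i))) * laurent_of_poly (m w (w_int n i))"
proof -
  let ?S = "{v. bruhat_le n v w}"
  let ?c = "\<lambda>v. of_int (aff_sign n (w \<otimes>\<^bsub>\<W>\<^esub> inv\<^bsub>\<W>\<^esub> v)) * laurent_of_poly (m w v)"
  have Hw: "H w = (\<Sum>v\<in>?S. scale (?c v) (C v))"
    and z: "\<not> bruhat_le n (w_int n i) w \<Longrightarrow> m w (w_int n i) = 0"
    using assms(3,4) w_int_closed[of i] by (auto simp: inverse_kl_polys_def)
  have "coords w (Some i) = act (H w) (Some i)" using assms(4) by (simp add: act_H)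
  also have "\<dots> = (\<Sum>v\<in>?S. ?c v * act (C v) (Some i))"
    unfolding Hw act_def lin_ext_sum lin_ext_scale ..
  also have "\<dots> = (\<Sum>v\<in>?S. if v = w_int n i then ?c v else 0)"
    using act_kl_basis[OF assms(1,2)] bruhat_le_imp(1) by (intro sum.cong) auto
  also have "\<dots> = ?c (w_int n i)"
    using z finite_bruhat_le[of w] by (auto simp: laurent_of_poly_0)
  finally show ?thesis .
qed

text \<open>The minus sign comes from the length of \<open>w_int n i\<close>, which is one more than
  the exponent \<open>\<bar>i\<bar>\<close> in \<open>eval_1_coords\<close>.\<close>

theorem inverse_kl_poly_at_1:
  assumes "bar_involution bar" "kl_basis bar P C" "inverse_kl_polys C m" "w \<in> \<C>"
  shows "poly (m w (w_int n i)) 1 = - z_total i (fst w)"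
proof -
  let ?e = "(- 1 :: int) ^ len n w * (- 1) ^ nat \<bar>i\<bar>"
  have "len n (w_int n i) = Suc (nat \<bar>i\<bar>)" using len_w_int[of i] by simp
  then have "aff_sign n (w \<otimes>\<^bsub>\<W>\<^esub> inv\<^bsub>\<W>\<^esub> (w_int n i)) = - ?e"
    unfolding aff_sign_mult_inv[OF assms(4) w_int_closed] by (simp add: aff_sign_def)
  then have "?e * z_total i (fst w) = - ?e * poly (m w (w_int n i)) 1"
    using arg_cong[OF inverse_kl_poly_coords[OF assms, of i], of eval_1]
    by (simp only: eval_1_coords[OF assms(4)] eval_1_of_int_times eval_1_laurent_of_poly)
  then have "?e * (z_total i (fst w) + poly (m w (w_int n i)) 1) = 0" by (simp add: distrib_left)
  then show ?thesis by simp
qed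

end

section \<open>Coset representatives and the final identity\<close>

lemma (in affine_A) w_gamma_coset:
  assumes "\<gamma> \<in> coroot_lattice n"
  shows "w_gamma n \<gamma> \<in> \<C>" "fst (w_gamma n \<gamma>) = \<gamma>"
proof -
  let ?P = "\<lambda>w. w \<in> translation \<gamma> <#\<^bsub>\<W>\<^esub> finite_weyl n"
  have P: "w \<in> \<C> \<and> fst w = \<gamma>" if "?P w" for w
    using that assms by (auto simp: l_coset_def translation_def finite_weyl_def mult_eq sym_group_carrier carrier_iff)
  have "?P (\<gamma>, id)"
    by (auto simp: l_coset_def translation_def finite_weyl_def mult_eq sym_group_carrier permutes_id intro!: bexI[of _ "(\<lambda>_. 0, id)"])
  then have "?P (w_gamma n \<gamma>)" unfolding w_gamma_def by (rule arg_min_natI)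
  then show "w_gamma n \<gamma> \<in> \<C>" "fst (w_gamma n \<gamma>) = \<gamma>" using P by blast+
qed

theorem mainTheorem11:
  fixes n :: nat
    and scale :: "laurent \<Rightarrow> 'h::ring_1 \<Rightarrow> 'h"
    and H C :: "aff \<Rightarrow> 'h"
    and bar :: "'h \<Rightarrow> 'h"
    and P m :: "aff \<Rightarrow> aff \<Rightarrow> int poly"
    and \<gamma> :: "nat \<Rightarrow> int"
    and i :: int
  assumes "n \<ge> 3"
    and "hecke_algebra scale n H"
    and "hecke_algebra.bar_involution scale n H bar"
    and "hecke_algebra.kl_basis scale n H bar P C"
    and "hecke_algebra.inverse_kl_polys scale n H C m"
    and "\<gamma> \<in> coroot_lattice n"
  shows "poly (m (w_gamma n \<gamma>) (w_int n i)) 1 = - (\<Sum>k=1..n. z_fun n i k (\<gamma> k))"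
proof -
  interpret affine_hecke scale n H
    using assms(1,2) by (simp add: affine_hecke_def affine_A_def)
  show ?thesis
    using inverse_kl_poly_at_1[OF assms(3-5) w_gamma_coset(1)[OF assms(6)], of i] w_gamma_coset(2)[OF assms(6)]
    by (simp add: z_total_def)
qed

end
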